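(* Let $\mathbb X$ and $\mathbb Y$ be minimal, aperiodic flow spaces with expansions $(X_i,f_i,p_i)$ and $(Y_i,g_i,q_i)$ in which every $X_i$ and every $Y_i$ is a copy of the same oriented wedge $W_n$ of $n$ circles, so that each $\pi_1(f_i)$ and $\pi_1(g_i)$ is an endomorphism of the free group $F_n=\pi_1(W_n)$. Suppose that $\pi_1(f_i)$ is an automorphism of $F_n$ for every $i$, and that for every $i$ there is $j>i$ such that $\pi_1(g_j)$ is not an automorphism. Then $\mathbb X$ and $\mathbb Y$ are not flow equivalent.
   Context: Flow space: compact metrizable space of topological dimension one with continuous $\mathbb R$-action without fixed points; minimal: all orbits dense; aperiodic: no periodic orbit; flow equivalence: homeomorphism mapping orbits to orbits preserving flow orientation. Expansion of $\mathbb X$ about a point $x_\bullet$: oriented wedges of circles $X_i$ with wedge points $x_i$, positive maps $f_i\colon X_{i+1}\to X_i$ (continuous surjections, wedge point to wedge point, orientation preserving on each circle, locally injective away from the wedge point), projections $p_i\colon\mathbb X\to X_i$ (continuous surjections, locally injective and orientation preserving along orbits) with $p_i(x_\bullet)=x_i$, $p_n=f_n\circ\cdots\circ f_{m-1}\circ p_m$, and $x\mapsto(p_i(x))_i$ a homeomorphism onto $\varprojlim(X_i,f_i)$. *)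

theory Defs
  imports "HOL-Analysis.Analysis"
begin

definition covering_dim_le :: "'a topology \<Rightarrow> nat \<Rightarrow> bool" where
  "covering_dim_le X d \<longleftrightarrow>
     (\<forall>\<U>. finite \<U> \<and> (\<forall>U\<in>\<U>. openin X U) \<and> topspace X \<subseteq> \<Union>\<U> \<longrightarrow>
        (\<exists>\<V>. finite \<V> \<and> (\<forall>V\<in>\<V>. openin X V) \<and> topspace X \<subseteq> \<Union>\<V> \<and>
             (\<forall>V\<in>\<V>. \<exists>U\<in>\<U>. V \<subseteq> U) \<and>
             (\<forall>x\<in>topspace X. card {V\<in>\<V>. x \<in> V} \<le> d + 1)))"

definition topological_dimension_one :: "'a topology \<Rightarrow> bool" where
  "topological_dimension_one X \<longleftrightarrow> covering_dim_le X 1 \<and> \<not> covering_dim_le X 0"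

definition flow :: "'a topology \<Rightarrow> (real \<Rightarrow> 'a \<Rightarrow> 'a) \<Rightarrow> bool" where
  "flow X \<phi> \<longleftrightarrow>
     continuous_map (prod_topology euclideanreal X) X (\<lambda>(t, x). \<phi> t x) \<and>
     (\<forall>x\<in>topspace X. \<phi> 0 x = x) \<and>
     (\<forall>s t. \<forall>x\<in>topspace X. \<phi> (s + t) x = \<phi> s (\<phi> t x))"

definition flow_space :: "'a topology \<Rightarrow> (real \<Rightarrow> 'a \<Rightarrow> 'a) \<Rightarrow> bool" where
  "flow_space X \<phi> \<longleftrightarrow>
     compact_space X \<and> metrizable_space X \<and> topological_dimension_one X \<and>
     flow X \<phi> \<and> (\<forall>x\<in>topspace X. \<exists>t. \<phi> t x \<noteq> x)"

definition orbit :: "(real \<Rightarrow> 'a \<Rightarrow> 'a) \<Rightarrow> 'a \<Rightarrow> 'a set" where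
  "orbit \<phi> x = range (\<lambda>t. \<phi> t x)"

definition minimal_flow :: "'a topology \<Rightarrow> (real \<Rightarrow> 'a \<Rightarrow> 'a) \<Rightarrow> bool" where
  "minimal_flow X \<phi> \<longleftrightarrow> (\<forall>x\<in>topspace X. X closure_of (orbit \<phi> x) = topspace X)"

definition aperiodic_flow :: "'a topology \<Rightarrow> (real \<Rightarrow> 'a \<Rightarrow> 'a) \<Rightarrow> bool" where
  "aperiodic_flow X \<phi> \<longleftrightarrow> (\<forall>x\<in>topspace X. \<forall>t. \<phi> t x = x \<longrightarrow> t = 0)"

definition flow_equivalent ::
  "'a topology \<Rightarrow> (real \<Rightarrow> 'a \<Rightarrow> 'a) \<Rightarrow> 'b topology \<Rightarrow> (real \<Rightarrow> 'b \<Rightarrow> 'b) \<Rightarrow> bool" where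
  "flow_equivalent X \<phi> Y \<psi> \<longleftrightarrow>
     (\<exists>h. homeomorphic_map X Y h \<and>
          (\<forall>x\<in>topspace X. \<exists>\<tau>::real \<Rightarrow> real. strict_mono \<tau> \<and> surj \<tau> \<and>
               (\<forall>t. h (\<phi> t x) = \<psi> (\<tau> t) (h x))))"

text \<open>Model of the wedge W_n in the complex plane: the circles of centre k and radius k,
  k = 1..n, which meet only at the wedge point 0. Circle k is parametrised
  (counterclockwise, i.e. positively oriented) by circ k, with circ k 0 = 0.\<close>
definition circ :: "nat \<Rightarrow> real \<Rightarrow> complex" where
  "circ k t = of_nat k - of_nat k * cis t"

definition wedge :: "nat \<Rightarrow> complex set" where
  "wedge n = (\<Union>k\<in>{1..n}. sphere (of_nat k) (real k))"

text \<open>A path in W_n that is locally injective and orientation preserving: near every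
  parameter value it runs positively (strictly increasingly) along circles, possibly
  passing from the end of one circle into the start of another at the wedge point.\<close>
definition positive_path :: "nat \<Rightarrow> (real \<Rightarrow> complex) \<Rightarrow> bool" where
  "positive_path n \<gamma> \<longleftrightarrow>
     (\<forall>t0. \<exists>\<epsilon>>0. \<exists>a\<in>{1..n}. \<exists>b\<in>{1..n}. \<exists>\<sigma>1 \<sigma>2.
        continuous_on {t0 - \<epsilon>..t0} \<sigma>1 \<and> strict_mono_on {t0 - \<epsilon>..t0} \<sigma>1 \<and>
        continuous_on {t0..t0 + \<epsilon>} \<sigma>2 \<and> strict_mono_on {t0..t0 + \<epsilon>} \<sigma>2 \<and>
        (\<forall>t\<in>{t0 - \<epsilon>..t0}. \<gamma> t = circ a (\<sigma>1 t)) \<and>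
        (\<forall>t\<in>{t0..t0 + \<epsilon>}. \<gamma> t = circ b (\<sigma>2 t)))"

definition positive_map :: "nat \<Rightarrow> (complex \<Rightarrow> complex) \<Rightarrow> bool" where
  "positive_map n f \<longleftrightarrow>
     continuous_on (wedge n) f \<and> f ` wedge n = wedge n \<and> f 0 = 0 \<and>
     (\<forall>k\<in>{1..n}. positive_path n (\<lambda>t. f (circ k t)))"

definition expansion ::
  "'a topology \<Rightarrow> (real \<Rightarrow> 'a \<Rightarrow> 'a) \<Rightarrow> nat \<Rightarrow> (nat \<Rightarrow> complex \<Rightarrow> complex)
     \<Rightarrow> (nat \<Rightarrow> 'a \<Rightarrow> complex) \<Rightarrow> 'a \<Rightarrow> bool" where
  "expansion X \<phi> n f p x0 \<longleftrightarrow>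
     x0 \<in> topspace X \<and>
     (\<forall>i. positive_map n (f i)) \<and>
     (\<forall>i. continuous_map X (top_of_set (wedge n)) (p i) \<and>
          p i ` topspace X = wedge n \<and> p i x0 = 0 \<and>
          (\<forall>x\<in>topspace X. positive_path n (\<lambda>t. p i (\<phi> t x)))) \<and>
     (\<forall>i. \<forall>x\<in>topspace X. p i x = f i (p (Suc i) x)) \<and>
     homeomorphic_map X
       (subtopology (product_topology (\<lambda>i::nat. top_of_set (wedge n)) UNIV)
                    {y. \<forall>i. y i = f i (y (Suc i))})
       (\<lambda>x i. p i x)"

definition based_loop :: "complex set \<Rightarrow> complex \<Rightarrow> (real \<Rightarrow> complex) \<Rightarrow> bool" where
  "based_loop S x \<gamma> \<longleftrightarrow> path \<gamma> \<and> path_image \<gamma> \<subseteq> S \<and> pathstart \<gamma> = x \<and> pathfinish \<gamma> = x"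

definition pi1_automorphism :: "nat \<Rightarrow> (complex \<Rightarrow> complex) \<Rightarrow> bool" where
  "pi1_automorphism n f \<longleftrightarrow>
     (\<forall>\<gamma>. based_loop (wedge n) 0 \<gamma> \<longrightarrow>
        (\<exists>\<delta>. based_loop (wedge n) 0 \<delta> \<and> homotopic_paths (wedge n) (f \<circ> \<delta>) \<gamma>)) \<and>
     (\<forall>\<delta>1 \<delta>2. based_loop (wedge n) 0 \<delta>1 \<and> based_loop (wedge n) 0 \<delta>2 \<and>
        homotopic_paths (wedge n) (f \<circ> \<delta>1) (f \<circ> \<delta>2) \<longrightarrow>
        homotopic_paths (wedge n) \<delta>1 \<delta>2)"

end

theory Submission
  imports Defs "HOL-Combinatorics.Permutations"
begin

text \<open>
  Only a homeomorphism between the inverse limits is needed. By Stone--Weierstrass and a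
  neighbourhood retraction onto the wedge, a map from an inverse limit to the wedge is, up to
  small error, a map of some coordinate. Applied to both directions of the homeomorphism, this gives
  a map b of the wedge such that, for all large i, the composition of
  \<open>c\<^sub>i = b \<circ> g\<^sub>k \<circ> \<dots> \<circ> g\<^sub>i\<^sub>-\<^sub>1\<close> with a suitable map is
  homotopic to \<open>f\<^sub>0 \<circ> \<dots> \<circ> f\<^sub>m\<^sub>-\<^sub>1\<close>, which is onto on \<open>\<pi>\<^sub>1\<close>.
  Hence \<open>c\<^sub>i\<close> is onto on \<open>\<pi>\<^sub>1\<close>, and bijective because free groups of finite rank are
  Hopfian; as \<open>c\<^sub>i\<^sub>+\<^sub>1 = c\<^sub>i \<circ> g\<^sub>i\<close>, so is every \<open>g\<^sub>i\<close> with i large.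

  The Hopf property is derived without the van Kampen theorem: loops in the wedge are homotopic to
  words in the circles, and finite coverings, given by a permutation for each circle, detect
  nontrivial reduced words.
\<close>

subsection \<open>Words and permutations\<close>

text \<open>The Hopf property is forced by one-sidedness: \<open>K (H x) = x\<close> makes
  \<open>c d \<circ> a\<close> homotopic to a composition of the maps \<open>f i\<close>, which
  yields surjectivity of \<open>c d\<close> on loops but says nothing about its kernel. The order of
  choices matters. The approximation \<open>b\<close> of coordinate 0 of \<open>K\<close> is fixed
  first, at a level \<open>k\<close>; only then, for each \<open>d\<close>, is coordinate
  \<open>k + d\<close> of \<open>H\<close> approximated, with an accuracy depending on
  \<open>d\<close>. So all the maps \<open>c d\<close> share the outer factor \<open>b\<close>, and
  \<open>c (Suc d) = c d \<circ> g (k + d)\<close> holds exactly, not just up to homotopy. The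
  obstacle is the base point: approximations and the homotopies between them move 0. The action on
  loops is therefore written as \<open>c d\<close> followed by conjugation with a path
  \<open>l\<close> from 0 to \<open>c d 0\<close>. As all bonding maps fix 0,
  \<open>c d 0 = b 0\<close>, and a single \<open>l\<close> serves every \<open>d\<close>. This is
  also why the Hopf property is proved for an abstract operation on loops and not for a map fixing
  0. A homomorphism from the free group to a symmetric group is a tuple of permutations, so for each
  degree there are finitely many; this finiteness turns surjectivity into injectivity.\<close>

lemma partial_injection_extends:
  assumes "finite A" "P \<subseteq> A \<times> A" "single_valued P" "single_valued (P\<inverse>)"
  obtains \<pi> where "\<pi> permutes A" "\<And>a b. (a, b) \<in> P \<Longrightarrow> \<pi> a = b"
proof -
  define g where "g a = (THE b. (a, b) \<in> P)" for a
  have g: "g a = b" if "(a, b) \<in> P" for a b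
    using that assms(3) unfolding g_def single_valued_def by blast
  have sub: "Domain P \<subseteq> A" "Range P \<subseteq> A"
    using assms(2) by auto
  have g_bij: "bij_betw g (Domain P) (Range P)"
  proof (rule bij_betw_imageI)
    show "inj_on g (Domain P)"
      using g assms(4) by (auto simp: inj_on_def single_valued_def)
    show "g ` Domain P = Range P"
      using g by (auto simp: image_def Range_iff)
  qed
  then have "card (Domain P) = card (Range P)"
    by (rule bij_betw_same_card)
  \<comment> \<open>In a finite set the complements of domain and range are equally large, so an
    arbitrary bijection between them completes the partial injection.\<close>
  then have "card (A - Domain P) = card (A - Range P)"
    using sub assms(1) by (simp add: card_Diff_subset finite_subset)
  then obtain h where h: "bij_betw h (A - Domain P) (A - Range P)"
    using assms(1) by (meson finite_Diff finite_same_card_bij)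
  define \<pi> where "\<pi> a = (if a \<in> Domain P then g a else if a \<in> A then h a else a)" for a
  have "bij_betw \<pi> (Domain P \<union> (A - Domain P)) (Range P \<union> (A - Range P))"
  proof (rule bij_betw_combine)
    show "bij_betw \<pi> (Domain P) (Range P)"
      using g_bij by (subst bij_betw_cong[of _ _ g]) (auto simp: \<pi>_def)
    show "bij_betw \<pi> (A - Domain P) (A - Range P)"
      using h by (subst bij_betw_cong[of _ _ h]) (auto simp: \<pi>_def)
  qed auto
  then have "bij_betw \<pi> A A"
    using sub by (simp add: Un_absorb1)
  then have "\<pi> permutes A"
    using sub by (intro bij_imp_permutes) (auto simp: \<pi>_def)
  moreover have "\<pi> a = b" if "(a, b) \<in> P" for a b
    using that g by (auto simp: \<pi>_def)
  ultimately show ?thesis using that by blast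
qed

definition letter_inv :: "nat \<times> bool \<Rightarrow> nat \<times> bool" where
  "letter_inv x = (fst x, \<not> snd x)"

definition letter_act :: "(nat \<Rightarrow> 'a \<Rightarrow> 'a) \<Rightarrow> nat \<times> bool \<Rightarrow> 'a \<Rightarrow> 'a" where
  "letter_act \<rho> x = (if snd x then \<rho> (fst x) else inv (\<rho> (fst x)))"

text \<open>Letters act in reading order, first letter first, to agree with the successive endpoints
  of a lifted loop. Concatenation of words therefore becomes composition in reverse order.\<close>

definition word_act :: "(nat \<Rightarrow> 'a \<Rightarrow> 'a) \<Rightarrow> (nat \<times> bool) list \<Rightarrow> 'a \<Rightarrow> 'a" where
  "word_act \<rho> w = fold (letter_act \<rho>) w"

definition word_inv :: "(nat \<times> bool) list \<Rightarrow> (nat \<times> bool) list" where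
  "word_inv w = rev (map letter_inv w)"

definition letters :: "nat \<Rightarrow> (nat \<times> bool) set" where
  "letters n = {1..n} \<times> UNIV"

text \<open>These are the homomorphisms from the free group on \<open>1..n\<close> to the symmetric
  group on \<open>{..m}\<close>. Fixing the value \<open>id\<close> at all other indices makes the
  set finite and lets tuples be compared as functions.\<close>

definition perm_tuples :: "nat \<Rightarrow> nat \<Rightarrow> (nat \<Rightarrow> nat \<Rightarrow> nat) set" where
  "perm_tuples n m = {\<rho>. (\<forall>k\<in>{1..n}. \<rho> k permutes {..m}) \<and> (\<forall>k. k \<notin> {1..n} \<longrightarrow> \<rho> k = id)}"

lemma letter_inv_simps [simp]:
  "letter_inv (letter_inv x) = x" "letter_inv (k, b) = (k, \<not> b)"
  "letter_inv x \<in> letters n \<longleftrightarrow> x \<in> letters n"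
  by (cases x; auto simp: letter_inv_def letters_def)+

lemma word_act_simps [simp]:
  "word_act \<rho> [] = id"
  "word_act \<rho> (x # w) = word_act \<rho> w \<circ> letter_act \<rho> x"
  "word_act \<rho> (u @ v) = word_act \<rho> v \<circ> word_act \<rho> u"
  by (auto simp: word_act_def)

lemma word_inv_simps [simp]:
  "word_inv [] = []" "word_inv (x # w) = word_inv w @ [letter_inv x]"
  "set (word_inv w) \<subseteq> letters n \<longleftrightarrow> set w \<subseteq> letters n"
  by (auto simp: word_inv_def image_subset_iff simp del: letter_inv_simps(2))

lemma perm_tuplesD: "\<rho> \<in> perm_tuples n m \<Longrightarrow> \<rho> k permutes {..m}"
  by (cases "k \<in> {1..n}") (auto simp: perm_tuples_def permutes_id)

lemma finite_perm_tuples: "finite (perm_tuples n m)"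
proof -
  have "perm_tuples n m \<subseteq> {\<rho>. \<forall>k. (k \<in> {1..n} \<longrightarrow> \<rho> k \<in> {p. p permutes {..m}}) \<and> (k \<notin> {1..n} \<longrightarrow> \<rho> k = id)}"
    by (auto simp: perm_tuples_def)
  then show ?thesis
    by (rule finite_subset) (intro finite_set_of_finite_funs finite_permutations; simp)
qed

lemma letter_act_permutes:
  "(\<And>k. \<rho> k permutes A) \<Longrightarrow> letter_act \<rho> x permutes A"
  by (simp add: letter_act_def permutes_inv)

lemma word_act_permutes:
  "(\<And>k. \<rho> k permutes A) \<Longrightarrow> word_act \<rho> w permutes A"
  by (induction w) (auto simp: permutes_id letter_act_permutes intro: permutes_compose)

lemma letter_act_cancel:
  assumes "\<And>k. \<rho> k permutes A"
  shows "letter_act \<rho> (letter_inv x) \<circ> letter_act \<rho> x = id"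
  using permutes_inv_o[OF assms] by (auto simp: letter_act_def letter_inv_def)

lemma inv_word_act:
  assumes "\<And>k. \<rho> k permutes A"
  shows "word_act \<rho> (word_inv w) = inv (word_act \<rho> w)"
proof (induction w)
  case (Cons x w)
  have "bij (word_act \<rho> w)" "bij (letter_act \<rho> x)"
    using word_act_permutes[of \<rho> A w, OF assms] letter_act_permutes[of \<rho> A x, OF assms] permutes_bij by blast+
  moreover have "inv (letter_act \<rho> x) = letter_act \<rho> (letter_inv x)"
    using permutes_bij[OF assms] by (auto simp: letter_act_def letter_inv_def inv_inv_eq)
  ultimately show ?case
    by (simp add: Cons.IH o_inv_distrib del: o_apply)
qed auto

text \<open>The word is read along a path of vertices 0, 1, \<dots>, length w; reducedness makes the
  edges with a fixed label a partial injection.\<close>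
lemma reduced_word_acts_nontrivially:
  assumes red: "successively (\<lambda>x y. y \<noteq> letter_inv x) w" and w: "set w \<subseteq> letters n"
  obtains \<rho> where "\<rho> \<in> perm_tuples n (length w)" "word_act \<rho> w 0 = length w"
proof -
  let ?l = "length w"
  define P where "P k = {(i, Suc i) | i. i < ?l \<and> w ! i = (k, True)} \<union> {(Suc i, i) | i. i < ?l \<and> w ! i = (k, False)}" for k
  have red': "w ! Suc i \<noteq> letter_inv (w ! i)" if "Suc i < ?l" for i
    using red that by (simp add: successively_conv_nth)
  have red'': False if "Suc i < ?l" "w ! i = (k, b)" "w ! Suc i = (k, \<not> b)" for i k b
    using red'[OF that(1)] that(2,3) by simp
  have "\<exists>\<pi>. \<pi> permutes {..?l} \<and> (\<forall>a b. (a, b) \<in> P k \<longrightarrow> \<pi> a = b)" for k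
  proof -
    have "P k \<subseteq> {..?l} \<times> {..?l}"
      by (auto simp: P_def)
    moreover have "single_valued (P k)" "single_valued ((P k)\<inverse>)"
      using red''[of _ k True] red''[of _ k False] by (auto simp: P_def single_valued_def)
    ultimately show ?thesis
      using partial_injection_extends[of "{..?l}" "P k"] by blast
  qed
  then obtain \<pi> where \<pi>: "\<And>k. \<pi> k permutes {..?l}" "\<And>k a b. (a, b) \<in> P k \<Longrightarrow> \<pi> k a = b"
    by metis
  define \<rho> where "\<rho> k = (if k \<in> {1..n} then \<pi> k else id)" for k
  have "word_act \<rho> (take i w) 0 = i" if "i \<le> ?l" for i
    using that
  proof (induction i)
    case (Suc i)
    obtain k b where kb: "w ! i = (k, b)" by fastforce
    have "w ! i \<in> set w"
      using Suc.prems by simp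
    then have k: "k \<in> {1..n}"
      using w kb by (auto simp: letters_def)
    have inv: "inv (\<pi> k) i = Suc i" if "\<pi> k (Suc i) = i"
      using \<pi>(1)[of k] that by (metis permutes_inverses(2))
    have "letter_act \<rho> (w ! i) i = Suc i"
    proof (cases b)
      case True
      then have "(i, Suc i) \<in> P k"
        using kb Suc.prems by (auto simp: P_def)
      then show ?thesis
        using \<pi>(2) k kb True by (auto simp: letter_act_def \<rho>_def)
    next
      case False
      then have "(Suc i, i) \<in> P k"
        using kb Suc.prems by (auto simp: P_def)
      then show ?thesis
        using \<pi>(2) k kb False inv by (auto simp: letter_act_def \<rho>_def)
    qed
    then show ?case
      using Suc by (simp add: take_Suc_conv_app_nth)
  qed auto
  from this[of ?l] have act: "word_act \<rho> w 0 = ?l" by simp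
  have "\<rho> \<in> perm_tuples n ?l"
    using \<pi>(1) by (simp add: perm_tuples_def \<rho>_def)
  then show ?thesis using act by (rule that)
qed

lemma not_successivelyE:
  assumes "\<not> successively P xs"
  obtains us x y vs where "xs = us @ [x, y] @ vs" "\<not> P x y"
proof -
  obtain i where i: "Suc i < length xs" "\<not> P (xs ! i) (xs ! Suc i)"
    using assms by (auto simp: successively_conv_nth)
  have "xs = take i xs @ drop i xs" by simp
  also have "drop i xs = [xs ! i, xs ! Suc i] @ drop (Suc (Suc i)) xs"
    unfolding Cons_nth_drop_Suc[OF Suc_lessD[OF i(1)], symmetric] Cons_nth_drop_Suc[OF i(1), symmetric] by simp
  finally show ?thesis using that i(2) by blast
qed

text \<open>Residual finiteness of the free group, phrased as an induction rule so that no free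
  group has to be constructed. A nonempty word acting trivially everywhere cannot be reduced,
  because a reduced word moves 0 to its own length; so it contains a cancelling pair, and deleting
  the pair changes none of the actions.\<close>

lemma residually_finite_word_induct:
  assumes w: "set w \<subseteq> letters n"
    and triv: "\<And>m \<rho>. \<rho> \<in> perm_tuples n m \<Longrightarrow> word_act \<rho> w = id"
    and Nil: "Q []"
    and cancel: "\<And>u x v. set u \<subseteq> letters n \<Longrightarrow> set v \<subseteq> letters n \<Longrightarrow> x \<in> letters n \<Longrightarrow> Q (u @ v) \<Longrightarrow> Q (u @ [x, letter_inv x] @ v)"
  shows "Q w"
  using w triv
proof (induction "length w" arbitrary: w rule: less_induct)
  case less
  show ?case
  proof (cases "successively (\<lambda>x y. y \<noteq> letter_inv x) w")
    case True
    then obtain \<rho> where "\<rho> \<in> perm_tuples n (length w)" "word_act \<rho> w 0 = length w"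
      using reduced_word_acts_nontrivially less.prems(1) by blast
    with less.prems(2)[of \<rho> "length w"] have "w = []" by simp
    then show ?thesis using Nil by simp
  next
    case False
    then obtain u x v where uv: "w = u @ [x, letter_inv x] @ v"
      using not_successivelyE[OF False] by blast
    have "word_act \<rho> (u @ v) = id" if \<rho>: "\<rho> \<in> perm_tuples n m" for \<rho> m
      using less.prems(2)[OF \<rho>] letter_act_cancel[of \<rho> "{..m}" x, OF perm_tuplesD[OF \<rho>]]
      by (simp add: uv comp_assoc)
    then have "Q (u @ v)"
      using less.hyps[of "u @ v"] less.prems(1) uv by simp
    then show ?thesis
      using cancel uv less.prems(1) by auto
  qed
qed

subsection \<open>Loops in the wedge\<close>

text \<open>This is the polar equation r = 2 k cos(angle) multiplied by r: free of square roots, and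
  true of the common point 0 of all the circles.\<close>

lemma sphere_circle_iff: "z \<in> sphere (of_nat k) (real k) \<longleftrightarrow> (cmod z)\<^sup>2 = 2 * real k * Re z"
proof -
  have "z \<in> sphere (of_nat k) (real k) \<longleftrightarrow> cmod (z - of_nat k) = real k"
    by (simp add: dist_norm norm_minus_commute)
  also have "\<dots> \<longleftrightarrow> (cmod (z - of_nat k))\<^sup>2 = (real k)\<^sup>2"
    by (simp add: power2_eq_iff_nonneg)
  also have "(cmod (z - of_nat k))\<^sup>2 = (cmod z)\<^sup>2 - 2 * real k * Re z + (real k)\<^sup>2"
    by (simp add: cmod_power2) (simp add: power2_eq_square algebra_simps)
  finally show ?thesis by simp
qed

lemma Re_circ: "Re (circ k t) = real k * (1 - cos t)" and Im_circ: "Im (circ k t) = - real k * sin t"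
  by (simp_all add: circ_def algebra_simps)

lemma circ_0 [simp]: "circ k 0 = 0" and circ_2pi [simp]: "circ k (2 * pi) = 0"
  by (simp_all add: circ_def complex_eq_iff)

lemma continuous_on_circ: "continuous_on A (circ k)"
  unfolding circ_def by (intro continuous_intros continuous_on_cis)

lemma circ_in_sphere: "circ k t \<in> sphere (of_nat k) (real k)"
  by (simp add: circ_def dist_norm norm_mult)

lemma circ_in_wedge: "k \<in> {1..n} \<Longrightarrow> circ k t \<in> wedge n"
  unfolding wedge_def using circ_in_sphere by blast

lemma wedge_sphereE:
  assumes "z \<in> wedge n"
  obtains k where "k \<in> {1..n}" "z \<in> sphere (of_nat k) (real k)"
  using assms by (auto simp: wedge_def)

text \<open>Since \<open>circ k t = z\<close> means \<open>cis t = 1 - z / k\<close>, the argument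
  of the right-hand side in [0, 2 pi) is a parameter for \<open>z\<close>.\<close>

lemma sphere_circE:
  assumes "z \<in> sphere (of_nat k) (real k)" "k \<ge> 1"
  shows "circ k (Arg2pi (1 - z / of_nat k)) = z"
proof -
  have "cmod (1 - z / of_nat k) = cmod (of_nat k - z) / real k"
  proof -
    have "1 - z / of_nat k = (of_nat k - z) / of_nat k"
      using assms(2) by (simp add: field_simps)
    then show ?thesis by (simp add: norm_divide)
  qed
  also have "\<dots> = 1"
    using assms by (simp add: dist_norm)
  finally have "1 - z / of_nat k = cis (Arg2pi (1 - z / of_nat k))"
    using Arg2pi_eq[of "1 - z / of_nat k"] by (simp add: cis_conv_exp mult.commute)
  then have "of_nat k * cis (Arg2pi (1 - z / of_nat k)) = of_nat k - z"
    using assms(2) by (simp add: field_simps)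
  then show ?thesis
    by (simp add: circ_def)
qed

lemma wedge_circE:
  assumes "z \<in> wedge n"
  obtains k a where "k \<in> {1..n}" "0 \<le> a" "a < 2 * pi" "z = circ k a"
  using assms
proof (rule wedge_sphereE)
  fix k assume k: "k \<in> {1..n}" "z \<in> sphere (of_nat k) (real k)"
  show ?thesis
    using that[of k "Arg2pi (1 - z / of_nat k)"] k sphere_circE[of z k] Arg2pi[of "1 - z / of_nat k"] by auto
qed

lemma circ_eq_0_iff:
  assumes "k \<ge> 1" "0 \<le> a" "a \<le> 2 * pi"
  shows "circ k a = 0 \<longleftrightarrow> a = 0 \<or> a = 2 * pi"
proof
  assume "circ k a = 0"
  then have "cos a = 1"
    using assms(1) Re_circ[of k a] by simp
  then obtain m :: int where "a = of_int m * (2 * pi)"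
    using cos_one_2pi_int by (metis mult.assoc mult.commute)
  with assms(2,3) have "0 \<le> m" "m \<le> 1"
    using pi_gt_zero by (auto simp: zero_le_mult_iff mult_le_cancel_right1)
  then show "a = 0 \<or> a = 2 * pi"
    using \<open>a = _\<close> by (cases "m = 0") (auto dest!: antisym)
qed auto

text \<open>Subtracting the equations of two different circles gives \<open>Re z = 0\<close>, and
  then either equation gives \<open>z = 0\<close>.\<close>

lemma sphere_circle_unique:
  fixes z :: complex
  assumes "z \<in> sphere (of_nat k) (real k)" "z \<in> sphere (of_nat l) (real l)" "z \<noteq> 0"
  shows "k = l"
proof -
  have "(cmod z)\<^sup>2 = 2 * real k * Re z" "(cmod z)\<^sup>2 = 2 * real l * Re z"
    using assms(1,2) unfolding sphere_circle_iff .
  then show ?thesis using assms(3) by auto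
qed

section \<open>Loops spelled by words\<close>

definition seg :: "nat \<Rightarrow> real \<Rightarrow> real \<Rightarrow> real \<Rightarrow> complex" where
  "seg k a b = circ k \<circ> linepath a b"

definition letter_loop :: "nat \<times> bool \<Rightarrow> real \<Rightarrow> complex" where
  "letter_loop x = (if snd x then seg (fst x) 0 (2 * pi) else seg (fst x) (2 * pi) 0)"

text \<open>Every word ends in a constant path, so a one-letter word gives its letter loop only up
  to homotopy; \<open>word_loop_single\<close> bridges the difference.\<close>

fun word_loop :: "(nat \<times> bool) list \<Rightarrow> real \<Rightarrow> complex" where
  "word_loop [] = linepath 0 0"
| "word_loop (x # w) = letter_loop x +++ word_loop w"

lemma seg_ends [simp]: "pathstart (seg k a b) = circ k a" "pathfinish (seg k a b) = circ k b"
  by (simp_all add: seg_def pathstart_compose pathfinish_compose)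

lemma path_circ_compose: "path p \<Longrightarrow> path (circ k \<circ> p)"
  by (intro path_continuous_image continuous_on_circ)

lemma path_seg [simp]: "path (seg k a b)"
  unfolding seg_def by (intro path_circ_compose) simp

lemma path_image_seg: "k \<in> {1..n} \<Longrightarrow> path_image (seg k a b) \<subseteq> wedge n"
  by (auto simp: seg_def path_image_def circ_in_wedge)

lemma reversepath_seg: "reversepath (seg k a b) = seg k b a"
  by (auto simp: seg_def reversepath_def linepath_def fun_eq_iff algebra_simps)

text \<open>Parameters live in the real line, the universal cover of the circle. It is convex, so
  parameter paths with the same ends are joined by a straight-line homotopy, which
  \<open>circ k\<close> carries to the wedge.\<close>

lemma circ_compose_homotopic:
  fixes p q :: "real \<Rightarrow> real"
  assumes "k \<in> {1..n}" "path p" "path q" "pathstart p = pathstart q" "pathfinish p = pathfinish q"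
  shows "homotopic_paths (wedge n) (circ k \<circ> p) (circ k \<circ> q)"
proof (rule homotopic_paths_continuous_image)
  show "homotopic_paths UNIV p q"
    using assms by (intro homotopic_paths_linear) auto
qed (use assms circ_in_wedge continuous_on_circ in auto)

lemma seg_join:
  "k \<in> {1..n} \<Longrightarrow> homotopic_paths (wedge n) (seg k a b +++ seg k b c) (seg k a c)"
  unfolding seg_def path_compose_join[symmetric] by (rule circ_compose_homotopic) auto

lemma letter_loop_ends [simp]: "pathstart (letter_loop x) = 0" "pathfinish (letter_loop x) = 0" "path (letter_loop x)"
  by (auto simp: letter_loop_def)

lemma path_image_letter_loop: "x \<in> letters n \<Longrightarrow> path_image (letter_loop x) \<subseteq> wedge n"
  by (auto simp: letter_loop_def letters_def intro!: subsetD[OF path_image_seg])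

lemma reversepath_letter_loop: "reversepath (letter_loop x) = letter_loop (letter_inv x)"
  by (auto simp: letter_loop_def letter_inv_def reversepath_seg)

lemma word_loop_ends [simp]: "pathstart (word_loop w) = 0" "pathfinish (word_loop w) = 0" "path (word_loop w)"
  by (induction w) auto

lemma path_image_word_loop:
  "set w \<subseteq> letters n \<Longrightarrow> 0 \<in> wedge n \<Longrightarrow> path_image (word_loop w) \<subseteq> wedge n"
  by (induction w) (auto simp: path_image_join intro: subsetD[OF path_image_letter_loop])

lemma homotopic_paths_join_left:
  "homotopic_paths S p p' \<Longrightarrow> path q \<Longrightarrow> path_image q \<subseteq> S \<Longrightarrow> pathfinish p = pathstart q \<Longrightarrow>
    homotopic_paths S (p +++ q) (p' +++ q)"
  by (rule homotopic_paths_join) auto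

lemma homotopic_paths_join_right:
  "homotopic_paths S q q' \<Longrightarrow> path p \<Longrightarrow> path_image p \<subseteq> S \<Longrightarrow> pathfinish p = pathstart q \<Longrightarrow>
    homotopic_paths S (p +++ q) (p +++ q')"
  by (rule homotopic_paths_join) auto

lemma word_loop_append:
  assumes "set u \<subseteq> letters n" "set v \<subseteq> letters n" "0 \<in> wedge n"
  shows "homotopic_paths (wedge n) (word_loop (u @ v)) (word_loop u +++ word_loop v)"
  using assms(1)
proof (induction u)
  case Nil
  then show ?case
    using homotopic_paths_lid'[of "word_loop v" "wedge n"] assms path_image_word_loop
    by (metis homotopic_paths_sym append_Nil word_loop.simps(1) word_loop_ends(1,3))
next
  case (Cons x u)
  then have "homotopic_paths (wedge n) (word_loop ((x # u) @ v)) (letter_loop x +++ (word_loop u +++ word_loop v))"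
    by (auto intro!: homotopic_paths_join_right path_image_letter_loop)
  also have "homotopic_paths (wedge n) \<dots> ((letter_loop x +++ word_loop u) +++ word_loop v)"
    using Cons.prems assms path_image_letter_loop path_image_word_loop by (intro homotopic_paths_assoc) auto
  finally show ?case by simp
qed

lemma word_loop_single:
  assumes "x \<in> letters n"
  shows "homotopic_paths (wedge n) (word_loop [x]) (letter_loop x)"
  using homotopic_paths_rid'[of "letter_loop x" "wedge n" 0] path_image_letter_loop[OF assms] by simp

lemma word_loop_cancel:
  assumes "set u \<subseteq> letters n" "set v \<subseteq> letters n" "x \<in> letters n" "0 \<in> wedge n"
  shows "homotopic_paths (wedge n) (word_loop (u @ [x, letter_inv x] @ v)) (word_loop (u @ v))"
proof -
  let ?h = "homotopic_paths (wedge n)"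
  note im = path_image_word_loop[OF assms(1,4)] path_image_word_loop[OF assms(2,4)]
    path_image_letter_loop[OF assms(3)] path_image_letter_loop[of "letter_inv x" n]
  have "?h (word_loop ([x, letter_inv x] @ v)) ((letter_loop x +++ letter_loop (letter_inv x)) +++ word_loop v)"
    using im assms by (auto intro: homotopic_paths_assoc)
  also have "?h \<dots> (linepath 0 0 +++ word_loop v)"
    using homotopic_paths_rinv[of "letter_loop x" "wedge n"] im
    by (intro homotopic_paths_join_left) (auto simp: reversepath_letter_loop)
  also have "?h \<dots> (word_loop v)"
    using im by (intro homotopic_paths_lid') auto
  finally have 1: "?h (word_loop ([x, letter_inv x] @ v)) (word_loop v)" .
  have "?h (word_loop (u @ [x, letter_inv x] @ v)) (word_loop u +++ word_loop ([x, letter_inv x] @ v))"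
    using assms by (intro word_loop_append) auto
  also have "?h \<dots> (word_loop u +++ word_loop v)"
    using im 1 by (intro homotopic_paths_join_right) auto
  also have "?h \<dots> (word_loop (u @ v))"
    using assms by (intro homotopic_paths_sym[OF word_loop_append]) auto
  finally show ?thesis .
qed

text \<open>The part of the wedge that remains after removing the points opposite to 0 is contracted by
  sending 1/z along the vertical line Re = 1/(2k), the image of circle k, to infinity.\<close>
definition star :: "nat \<Rightarrow> complex set" where
  "star n = {z \<in> wedge n. z = 0 \<or> Im z \<noteq> 0}"

lemma contractible_star: "contractible (star n)"
proof -
  \<comment> \<open>\<open>1 / h (t, z)\<close> is \<open>1 / z\<close> with its imaginary part
    divided by \<open>1 - t\<close>. Clearing denominators makes the formula meaningful at
    \<open>t = 1\<close>, and division by zero being zero gives the right value 0 at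
    \<open>z = 0\<close>.\<close>
  define h :: "real \<times> complex \<Rightarrow> complex" where
    "h = (\<lambda>(t, z). of_real ((1 - t) * (cmod z)\<^sup>2) / Complex ((1 - t) * Re z) (- Im z))"
  have "continuous_on ({0..1} \<times> star n) h"
    unfolding continuous_on_eq_continuous_within
  proof
    fix tz assume tz: "tz \<in> {0..1::real} \<times> star n"
    obtain t z where [simp]: "tz = (t, z)" by fastforce
    show "continuous (at tz within {0..1} \<times> star n) h"
    proof (cases "z = 0")
      case False
      then have "Im z \<noteq> 0" using tz by (auto simp: star_def)
      then show ?thesis
        unfolding h_def case_prod_unfold Complex_eq continuous_within
        by (intro tendsto_intros) (auto simp: complex_eq_iff)
    next
      case True
      \<comment> \<open>Stretching the imaginary part of \<open>1 / z\<close> cannot decrease its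
        modulus, so \<open>h\<close> never increases the modulus of \<open>z\<close>. This gives
        continuity at \<open>z = 0\<close> for all times, including \<open>t = 1\<close>, where the
        denominator degenerates.\<close>
      have bound: "norm (h y) \<le> norm (snd y)" if y: "y \<in> {0..1} \<times> star n" for y
      proof -
        obtain s x where [simp]: "y = (s, x)" by fastforce
        define c where "c = Complex ((1 - s) * Re x) (- Im x)"
        have s: "0 \<le> 1 - s" "1 - s \<le> 1" using y by auto
        have "((1 - s) * cmod x)\<^sup>2 \<le> (cmod c)\<^sup>2"
          using s mult_right_mono[of "(1 - s)\<^sup>2" 1 "(Im x)\<^sup>2"]
          by (simp add: c_def power_mult_distrib cmod_power2 distrib_left power_le_one)
        then have le: "(1 - s) * cmod x \<le> cmod c"
          by (rule power2_le_imp_le) simp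
        have "norm (h y) = (1 - s) * cmod x * cmod x / cmod c"
          using s by (simp only: \<open>y = (s, x)\<close> h_def c_def prod.case norm_divide norm_of_real)
            (simp add: abs_mult power2_eq_square)
        also have "\<dots> \<le> cmod x"
        proof (cases "cmod c = 0")
          case False
          then show ?thesis
            using mult_right_mono[OF le, of "cmod x"] by (simp add: divide_le_eq mult.commute)
        qed auto
        finally show ?thesis by simp
      qed
      have "((\<lambda>y. snd y) \<longlongrightarrow> snd tz) (at tz within {0..1} \<times> star n)"
        by (intro tendsto_intros)
      then have "((\<lambda>y. norm (snd y)) \<longlongrightarrow> 0) (at tz within {0..1} \<times> star n)"
        using True tendsto_norm_zero by fastforce
      moreover have "\<forall>\<^sub>F y in at tz within {0..1} \<times> star n. norm (h y) \<le> norm (snd y)"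
        unfolding eventually_at_filter by (intro always_eventually allI impI bound)
      ultimately have "(h \<longlongrightarrow> 0) (at tz within {0..1} \<times> star n)"
        by (rule Lim_null_comparison[rotated])
      then show ?thesis
        using True by (simp add: continuous_within h_def)
    qed
  qed
  moreover have "h ` ({0..1} \<times> star n) \<subseteq> star n"
  proof clarsimp
    fix t :: real and z assume t: "0 \<le> t" "t \<le> 1" and z: "z \<in> star n"
    then have "z \<in> wedge n" by (simp add: star_def)
    then obtain k where k: "k \<in> {1..n}" "(cmod z)\<^sup>2 = 2 * real k * Re z"
      by (metis wedge_sphereE sphere_circle_iff)
    define u c where "u = 1 - t" and "c = Complex (u * Re z) (- Im z)"
    have h: "h (t, z) = of_real (u * (cmod z)\<^sup>2) / c"
      by (simp add: h_def u_def c_def)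
    have 0: "(0::complex) \<in> wedge n"
      using k circ_in_wedge[of k n 0] by simp
    show "h (t, z) \<in> star n"
    proof (cases "z = 0 \<or> u = 0")
      case True
      then show ?thesis using 0 by (auto simp: h star_def)
    next
      case False
      then have Im: "Im z \<noteq> 0" using z by (auto simp: star_def)
      then have c: "cmod c \<noteq> 0" by (auto simp: c_def complex_eq_iff)
      let ?r = "u * (cmod z)\<^sup>2"
      have re: "Re (h (t, z)) = ?r * (u * Re z) / (cmod c)\<^sup>2"
        unfolding h by (subst Re_divide) (simp add: c_def cmod_power2)
      have im: "Im (h (t, z)) = ?r * Im z / (cmod c)\<^sup>2"
        unfolding h by (subst Im_divide) (simp add: c_def cmod_power2)
      have "(cmod (h (t, z)))\<^sup>2 = ?r * ?r / (cmod c)\<^sup>2"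
        unfolding h by (simp add: norm_divide norm_mult power_divide power_mult_distrib power2_eq_square)
      also have "\<dots> = 2 * real k * Re (h (t, z))"
        unfolding re by (subst (2) k(2)) (simp add: algebra_simps)
      finally have "h (t, z) \<in> wedge n"
        using k(1) sphere_circle_iff[of "h (t, z)" k] by (auto simp: wedge_def)
      moreover have "Im (h (t, z)) \<noteq> 0"
        unfolding im using False c Im by simp
      ultimately show ?thesis by (simp add: star_def)
    qed
  qed
  moreover have "h (0, z) = z" for z
    by (cases "z = 0") (simp_all add: h_def complex_norm_square cnj.code[symmetric] del: of_real_power)
  moreover have "h (1, z) = 0" for z
    by (simp add: h_def)
  ultimately have "homotopic_with_canon (\<lambda>x. True) (star n) (star n) (\<lambda>x. x) (\<lambda>x. 0)"
    unfolding homotopic_with_def by (intro exI[of _ h]) (auto simp: image_subset_iff)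
  then show ?thesis
    by (auto simp: contractible_def id_def)
qed

section \<open>Every loop is homotopic to a word\<close>

text \<open>The invariant for growing a path piece by piece: its end may lie inside a circle, so a
  word is followed by an arc from 0. Both \<open>a = 0\<close> and \<open>a = 2 * pi\<close> are
  allowed for an end at 0.\<close>

definition word_arc :: "nat \<Rightarrow> (real \<Rightarrow> complex) \<Rightarrow> bool" where
  "word_arc n \<gamma> \<longleftrightarrow> (\<exists>w k a. set w \<subseteq> letters n \<and> k \<in> {1..n} \<and> 0 \<le> a \<and> a \<le> 2 * pi \<and>
     homotopic_paths (wedge n) \<gamma> (word_loop w +++ seg k 0 a))"

lemma word_arc_homotopic:
  "homotopic_paths (wedge n) \<gamma> \<delta> \<Longrightarrow> word_arc n \<delta> \<Longrightarrow> word_arc n \<gamma>"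
  unfolding word_arc_def by (meson homotopic_paths_trans)

lemma zero_in_wedge: "k \<in> {1..n} \<Longrightarrow> 0 \<in> wedge n"
  using circ_in_wedge[of k n 0] by simp

text \<open>Removing 0 from the circle keeps \<open>1 - z / l\<close> off the nonnegative reals,
  where \<open>Arg2pi\<close> jumps. So \<open>q\<close> lifts continuously to parameters, becomes
  \<open>seg l a b\<close>, and merges with the final arc without changing the word.\<close>

lemma word_arc_circle_step:
  assumes \<gamma>: "word_arc n \<gamma>" and l: "l \<in> {1..n}"
    and q: "path q" "path_image q \<subseteq> sphere (of_nat l) (real l) - {0}" "pathstart q = pathfinish \<gamma>"
  shows "word_arc n (\<gamma> +++ q)"
proof -
  let ?h = "homotopic_paths (wedge n)"
  obtain w k a where w: "set w \<subseteq> letters n" "k \<in> {1..n}" "0 \<le> a" "a \<le> 2 * pi"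
    "?h \<gamma> (word_loop w +++ seg k 0 a)"
    using \<gamma> unfolding word_arc_def by blast
  have start: "pathstart q = circ k a"
    using homotopic_paths_imp_pathfinish[OF w(5)] q(3) by simp
  have "circ k a \<in> sphere (of_nat l) (real l)" "circ k a \<noteq> 0"
    using pathstart_in_path_image[of q] q(2) start by auto
  then have kl: "k = l"
    using sphere_circle_unique circ_in_sphere by blast
  have a: "0 < a" "a < 2 * pi"
    using \<open>circ k a \<noteq> 0\<close> w(3,4) by (auto simp: less_le)
  define r where "r = Arg2pi \<circ> (\<lambda>z. 1 - z / of_nat l) \<circ> q"
  have mod: "circ l (r t) = q t" "0 \<le> r t" "r t < 2 * pi" "1 - q t / of_nat l \<notin> \<real>\<^sub>\<ge>\<^sub>0" if "t \<in> {0..1}" for t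
  proof -
    have qt: "q t \<in> sphere (of_nat l) (real l)" "q t \<noteq> 0"
      using subsetD[OF q(2), of "q t"] that by (auto simp: path_image_def)
    show c: "circ l (r t) = q t"
      using sphere_circE[OF qt(1)] l by (simp add: r_def)
    show "0 \<le> r t" "r t < 2 * pi"
      using Arg2pi[of "1 - q t / of_nat l"] by (auto simp: r_def)
    show "1 - q t / of_nat l \<notin> \<real>\<^sub>\<ge>\<^sub>0"
    proof
      assume "1 - q t / of_nat l \<in> \<real>\<^sub>\<ge>\<^sub>0"
      then have "Arg2pi (1 - q t / of_nat l) = 0"
        by (auto simp: Arg2pi_eq_0 complex_nonneg_Reals_iff complex_is_Real_iff)
      then show False using c qt(2) by (simp add: r_def)
    qed
  qed
  have "path r"
    unfolding r_def o_assoc[symmetric]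
  proof (rule path_continuous_image)
    show "path ((\<lambda>z. 1 - z / of_nat l) \<circ> q)"
      using l by (intro path_continuous_image q(1) continuous_intros) auto
    show "continuous_on (path_image ((\<lambda>z. 1 - z / of_nat l) \<circ> q)) Arg2pi"
      using mod(4) by (intro continuous_at_imp_continuous_on ballI continuous_at_Arg2pi)
        (auto simp: path_image_def)
  qed
  define b where "b = r 1"
  have "r 0 = a"
  proof -
    have "circ l (r 0) = circ l a" using mod(1)[of 0] start kl by (simp add: pathstart_def)
    then have "cis (r 0) = cis a" using l by (simp add: circ_def)
    moreover have "Arg2pi (cis c) = c" if "0 \<le> c" "c < 2 * pi" for c
      using that by (intro Arg2pi_unique[of 1]) (auto simp: cis_conv_exp)
    ultimately show ?thesis
      using mod(2,3)[of 0] a by (metis atLeastAtMost_iff less_imp_le zero_le_one order_refl)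
  qed
  have "?h q (circ l \<circ> r)"
  proof (rule homotopic_paths_eq)
    show "path_image q \<subseteq> wedge n" using q(2) l by (auto simp: wedge_def)
  qed (use q(1) mod(1) in auto)
  also have "?h \<dots> (seg l a b)"
    unfolding seg_def using \<open>path r\<close> \<open>r 0 = a\<close> l
    by (intro circ_compose_homotopic) (auto simp: b_def pathstart_def pathfinish_def linepath_0' linepath_1')
  finally have q_seg: "?h q (seg l a b)" .
  have im: "path_image (word_loop w) \<subseteq> wedge n"
    using w(1,2) path_image_word_loop zero_in_wedge by blast
  have "?h (\<gamma> +++ q) ((word_loop w +++ seg l 0 a) +++ seg l a b)"
    using w(5) q_seg q(3) kl by (intro homotopic_paths_join) auto
  also have "?h \<dots> (word_loop w +++ (seg l 0 a +++ seg l a b))"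
    using im l path_image_seg by (intro homotopic_paths_sym[OF homotopic_paths_assoc]) auto
  also have "?h \<dots> (word_loop w +++ seg l 0 b)"
    using im l by (intro homotopic_paths_join_right seg_join) auto
  finally show ?thesis
    unfolding word_arc_def using w(1) l mod(2,3)[of 1] by (fastforce simp: b_def)
qed

text \<open>The way from 0 to \<open>circ k a\<close> that avoids the point at parameter
  \<open>pi\<close>, opposite to 0, and hence stays inside \<open>star n\<close>; past
  \<open>pi\<close> it runs backwards from \<open>2 * pi\<close>.\<close>

definition short_seg :: "nat \<Rightarrow> real \<Rightarrow> real \<Rightarrow> complex" where
  "short_seg k a = (if a < pi then seg k 0 a else seg k (2 * pi) a)"

lemma short_seg_ends [simp]:
  "pathstart (short_seg k a) = 0" "pathfinish (short_seg k a) = circ k a" "path (short_seg k a)"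
  by (auto simp: short_seg_def)

lemma circ_in_star_iff:
  assumes "k \<in> {1..n}" "0 \<le> a" "a \<le> 2 * pi"
  shows "circ k a \<in> star n \<longleftrightarrow> a \<noteq> pi"
proof (cases "a = 0 \<or> a = 2 * pi")
  case True
  then show ?thesis using zero_in_wedge[OF assms(1)] by (auto simp: star_def)
next
  case False
  have "sin a = 0 \<longleftrightarrow> a = pi"
  proof (cases "a < pi")
    case True
    then show ?thesis using sin_gt_zero[of a] False assms by auto
  next
    case False
    with \<open>\<not> (a = 0 \<or> _)\<close> show ?thesis using sin_lt_zero[of a] assms by (cases "a = pi") auto
  qed
  then show ?thesis
    using False assms circ_eq_0_iff[of k a] circ_in_wedge[OF assms(1)] by (auto simp: star_def Im_circ)
qed

lemma path_image_short_seg: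
  assumes k: "k \<in> {1..n}" and a: "0 \<le> a" "a \<le> 2 * pi" "a \<noteq> pi"
  shows "path_image (short_seg k a) \<subseteq> star n"
proof -
  have "path_image (seg k c d) = circ k ` closed_segment c d" for c d
    by (simp add: seg_def path_image_compose)
  moreover have "\<forall>x\<in>closed_segment 0 a. 0 \<le> x \<and> x \<le> 2 * pi \<and> x \<noteq> pi" if "a < pi"
    using that a by (auto simp: closed_segment_eq_real_ivl)
  moreover have "\<forall>x\<in>closed_segment (2 * pi) a. 0 \<le> x \<and> x \<le> 2 * pi \<and> x \<noteq> pi" if "\<not> a < pi"
    using that a by (auto simp: closed_segment_eq_real_ivl)
  ultimately show ?thesis
    using k by (auto simp: short_seg_def circ_in_star_iff)
qed

text \<open>A contractible set is simply connected, so \<open>q\<close> may be replaced by the short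
  way back to 0 followed by the short way out to its end. New letters record only the difference
  between these short ways and the arcs \<open>seg k 0 a\<close> and \<open>seg l 0 b\<close> used
  by the invariant.\<close>

lemma word_arc_star_step:
  assumes \<gamma>: "word_arc n \<gamma>"
    and q: "path q" "path_image q \<subseteq> star n" "pathstart q = pathfinish \<gamma>"
  shows "word_arc n (\<gamma> +++ q)"
proof -
  let ?h = "homotopic_paths (wedge n)"
  obtain w k a where w: "set w \<subseteq> letters n" "k \<in> {1..n}" "0 \<le> a" "a \<le> 2 * pi"
    "?h \<gamma> (word_loop w +++ seg k 0 a)"
    using \<gamma> unfolding word_arc_def by blast
  have star: "star n \<subseteq> wedge n" by (auto simp: star_def)
  have start: "pathstart q = circ k a"
    using homotopic_paths_imp_pathfinish[OF w(5)] q(3) by simp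
  then have "circ k a \<in> star n"
    using pathstart_in_path_image[of q] q(2) by auto
  then have a: "a \<noteq> pi"
    using circ_in_star_iff w by auto
  have finish: "pathfinish q \<in> star n"
    using pathfinish_in_path_image[of q] q(2) by auto
  then obtain l b where l: "l \<in> {1..n}" "0 \<le> b" "b < 2 * pi" "pathfinish q = circ l b"
    using wedge_circE star by (metis subsetD)
  then have b: "b \<noteq> pi"
    using finish circ_in_star_iff by auto
  have q_eq: "?h q (reversepath (short_seg k a) +++ short_seg l b)"
  proof (rule homotopic_paths_subset[OF _ star])
    have "simply_connected (star n)"
      by (simp add: contractible_imp_simply_connected contractible_star)
    then show "homotopic_paths (star n) q (reversepath (short_seg k a) +++ short_seg l b)"
      using q l start path_image_short_seg[OF w(2-4) a] path_image_short_seg[OF l(1,2) _ b]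
      unfolding simply_connected_eq_homotopic_paths
      by (auto simp: subset_path_image_join)
  qed
  \<comment> \<open>If \<open>a\<close> is past \<open>pi\<close>, returning to 0 completes the
    circle forwards. If \<open>b\<close> is past \<open>pi\<close>, the short way out comes from the
    far end, which is one backward turn followed by the forward arc.\<close>
  define u where "u = (if a < pi then [] else [(k, True)])"
  define v where "v = (if b < pi then [] else [(l, False)])"
  have uv: "set u \<subseteq> letters n" "set v \<subseteq> letters n"
    using w(2) l(1) by (auto simp: u_def v_def letters_def)
  have 0: "0 \<in> wedge n" using w(2) zero_in_wedge by blast
  have im [simp]: "path_image (word_loop w) \<subseteq> wedge n" "path_image (word_loop u) \<subseteq> wedge n"
    "path_image (word_loop v) \<subseteq> wedge n" "path_image (seg k c d) \<subseteq> wedge n"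
    "path_image (seg l c d) \<subseteq> wedge n"
    "path_image (short_seg k a) \<subseteq> wedge n" "path_image (short_seg l b) \<subseteq> wedge n" for c d
    using path_image_word_loop[OF _ 0] w uv path_image_seg l path_image_short_seg[OF w(2-4) a]
      path_image_short_seg[OF l(1,2) _ b] star by auto
  have u: "?h (seg k 0 a +++ reversepath (short_seg k a)) (word_loop u)"
  proof (cases "a < pi")
    case True
    then show ?thesis
      using homotopic_paths_rinv[of "seg k 0 a" "wedge n"] by (simp add: u_def short_seg_def)
  next
    case False
    have "?h (seg k 0 a +++ seg k a (2 * pi)) (letter_loop (k, True))"
      using seg_join[OF w(2)] by (simp add: letter_loop_def)
    also have "?h \<dots> (word_loop [(k, True)])"
      using w(2) by (intro homotopic_paths_sym[OF word_loop_single]) (auto simp: letters_def)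
    finally show ?thesis
      using False by (simp add: u_def short_seg_def reversepath_seg)
  qed
  have v: "?h (short_seg l b) (word_loop v +++ seg l 0 b)"
  proof (cases "b < pi")
    case True
    then show ?thesis
      by (simp add: v_def short_seg_def) (metis homotopic_paths_lid' homotopic_paths_sym im(5) path_seg seg_ends(1) circ_0)
  next
    case False
    have "?h (seg l (2 * pi) b) (seg l (2 * pi) 0 +++ seg l 0 b)"
      using seg_join[OF l(1)] homotopic_paths_sym by blast
    also have "?h \<dots> (word_loop [(l, False)] +++ seg l 0 b)"
      using word_loop_single[of "(l, False)" n] l(1)
      by (intro homotopic_paths_join_left) (auto simp: letters_def letter_loop_def homotopic_paths_sym_eq)
    finally show ?thesis
      using False by (simp add: v_def short_seg_def)
  qed
  let ?w = "word_loop w" and ?u = "word_loop u" and ?v = "word_loop v"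
  have "?h (\<gamma> +++ q) ((?w +++ seg k 0 a) +++ (reversepath (short_seg k a) +++ short_seg l b))"
    using w(5) q_eq q(3) by (intro homotopic_paths_join) auto
  also have "?h \<dots> (?w +++ (seg k 0 a +++ (reversepath (short_seg k a) +++ short_seg l b)))"
    by (intro homotopic_paths_sym[OF homotopic_paths_assoc]) (auto simp: subset_path_image_join)
  also have "?h \<dots> (?w +++ ((seg k 0 a +++ reversepath (short_seg k a)) +++ short_seg l b))"
    by (intro homotopic_paths_join_right homotopic_paths_assoc) auto
  also have "?h \<dots> (?w +++ (?u +++ (?v +++ seg l 0 b)))"
    by (intro homotopic_paths_join_right homotopic_paths_join u v) auto
  also have "?h \<dots> (?w +++ ((?u +++ ?v) +++ seg l 0 b))"
    by (intro homotopic_paths_join_right homotopic_paths_assoc) auto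
  also have "?h \<dots> (?w +++ (word_loop (u @ v) +++ seg l 0 b))"
    using uv 0 by (intro homotopic_paths_join_right homotopic_paths_join_left homotopic_paths_sym[OF word_loop_append]) auto
  also have "?h \<dots> ((?w +++ word_loop (u @ v)) +++ seg l 0 b)"
    using path_image_word_loop[OF _ 0] uv by (intro homotopic_paths_assoc) auto
  also have "?h \<dots> (word_loop (w @ u @ v) +++ seg l 0 b)"
    using uv w 0 by (intro homotopic_paths_join_left homotopic_paths_sym[OF word_loop_append]) auto
  finally show ?thesis
    unfolding word_arc_def using w(1) uv l by (intro exI[of _ "w @ u @ v"] exI[of _ l] exI[of _ b]) auto
qed

text \<open>Only the real points \<open>2 * k\<close> with \<open>k\<close> in \<open>{1..n}\<close>
  are missing, and a finite set is closed.\<close>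

lemma openin_star: "openin (top_of_set (wedge n)) (star n)"
proof -
  have "finite (wedge n - star n)"
  proof (rule finite_subset)
    show "wedge n - star n \<subseteq> (\<lambda>k. of_nat (2 * k)) ` {1..n}"
    proof
      fix z assume z: "z \<in> wedge n - star n"
      then obtain k where k: "k \<in> {1..n}" "(cmod z)\<^sup>2 = 2 * real k * Re z"
        by (metis wedge_sphereE sphere_circle_iff DiffD1)
      have "Im z = 0" "z \<noteq> 0" using z by (auto simp: star_def)
      then have "Re z * Re z = 2 * real k * Re z" "Re z \<noteq> 0"
        using k(2) unfolding cmod_power2 by (auto simp: power2_eq_square complex_eq_iff)
      then have "z = of_nat (2 * k)"
        using \<open>Im z = 0\<close> by (auto simp: complex_eq_iff)
      then show "z \<in> (\<lambda>k. of_nat (2 * k)) ` {1..n}" using k(1) by blast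
    qed
  qed auto
  then have "closed (wedge n - star n)" by (rule finite_imp_closed)
  moreover have "star n = wedge n \<inter> - (wedge n - star n)" by (auto simp: star_def)
  ultimately show ?thesis by (metis open_Compl openin_open_Int)
qed

lemma openin_punctured_circle:
  assumes "k \<in> {1..n}"
  shows "openin (top_of_set (wedge n)) (sphere (of_nat k) (real k) - {0})"
proof -
  let ?C = "insert 0 (\<Union>l\<in>{1..n} - {k}. sphere (of_nat l) (real l)) :: complex set"
  have "closed ?C"
    by (intro closed_insert closed_UN) auto
  moreover have "sphere (of_nat k) (real k) - {0} = wedge n \<inter> - ?C"
    using sphere_circle_unique[of _ k] assms unfolding wedge_def by blast
  ultimately show ?thesis by (metis open_Compl openin_open_Int)
qed

text \<open>The star serves the wedge point and the punctured circles serve all other points,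
  including those missing from the star.\<close>

lemma wedge_cover_step:
  assumes "z \<in> wedge n"
  obtains T where "openin (top_of_set (wedge n)) T" "z \<in> T"
    "\<And>\<gamma> q. \<lbrakk>word_arc n \<gamma>; path q; path_image q \<subseteq> T; pathstart q = pathfinish \<gamma>\<rbrakk> \<Longrightarrow> word_arc n (\<gamma> +++ q)"
proof (cases "z = 0")
  case True
  then have "z \<in> star n" using assms by (auto simp: star_def)
  then show ?thesis using that[OF openin_star] word_arc_star_step by blast
next
  case False
  obtain k where "k \<in> {1..n}" "z \<in> sphere (of_nat k) (real k)"
    using assms by (rule wedge_sphereE)
  then show ?thesis
    using that[OF openin_punctured_circle, of k] word_arc_circle_step[of n _ k] False by blast
qed

text \<open>Instead of subdividing the interval, connectedness is used: whether the initial piece up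
  to \<open>t\<close> satisfies the invariant is locally constant in \<open>t\<close>.\<close>

lemma word_arc_path:
  assumes \<gamma>: "path \<gamma>" "path_image \<gamma> \<subseteq> wedge n" "pathstart \<gamma> = 0"
  shows "word_arc n \<gamma>"
proof -
  define G where "G t = word_arc n (subpath 0 t \<gamma>)" for t
  have "0 \<in> wedge n"
    using \<gamma> pathstart_in_path_image[of \<gamma>] by auto
  then obtain k where k: "k \<in> {1..n}" by (rule wedge_sphereE)
  have [simp]: "\<gamma> 0 = 0" using \<gamma>(3) by (simp add: pathstart_def)
  have join: "homotopic_paths (wedge n) (subpath 0 s \<gamma> +++ subpath s t \<gamma>) (subpath 0 t \<gamma>)"
    if "s \<in> {0..1}" "t \<in> {0..1}" for s t
    using that \<gamma> by (intro homotopic_join_subpaths) auto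
  have "G 0 \<longleftrightarrow> G 1"
  proof (rule connected_equivalence_relation[of "{0..1::real}" 0 1 "\<lambda>s t. G s \<longleftrightarrow> G t"])
    fix s :: real assume s: "s \<in> {0..1}"
    then have "\<gamma> s \<in> wedge n" using \<gamma>(2) by (auto simp: path_image_def)
    then obtain T where T: "openin (top_of_set (wedge n)) T" "\<gamma> s \<in> T"
      and step: "\<And>\<gamma> q. \<lbrakk>word_arc n \<gamma>; path q; path_image q \<subseteq> T; pathstart q = pathfinish \<gamma>\<rbrakk> \<Longrightarrow> word_arc n (\<gamma> +++ q)"
      by (rule wedge_cover_step) blast
    have "openin (top_of_set {0..1}) ({0..1} \<inter> \<gamma> -` T)"
      using \<gamma> T by (intro continuous_openin_preimage[of _ _ "wedge n"]) (auto simp: path_def path_image_def)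
    then obtain e where e: "e > 0" "ball s e \<inter> {0..1} \<subseteq> {0..1} \<inter> \<gamma> -` T"
      using s T(2) unfolding openin_contains_ball by blast
    \<comment> \<open>The order of \<open>r\<close> and \<open>t\<close> is left open: for
      \<open>t < r\<close> the subpath runs backwards, and the same step applies. This gives the
      equivalence of \<open>G s\<close> and \<open>G t\<close>.\<close>
    have mono: "G t" if "G r" "r \<in> ball s e \<inter> {0..1}" "t \<in> ball s e \<inter> {0..1}" for r t
    proof -
      have "convex (ball s e \<inter> {0..1})" by (intro convex_Int) auto
      then have "closed_segment r t \<subseteq> ball s e \<inter> {0..1}"
        using that by (simp add: closed_segment_subset)
      then have "path_image (subpath r t \<gamma>) \<subseteq> T"
        using e(2) by (auto simp: path_image_subpath_gen)
      then have "word_arc n (subpath 0 r \<gamma> +++ subpath r t \<gamma>)"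
        using that \<gamma> by (intro step) (auto simp: G_def)
      then show ?thesis
        using join[of r t] that homotopic_paths_sym word_arc_homotopic unfolding G_def by blast
    qed
    show "\<exists>T. openin (top_of_set {0..1}) T \<and> s \<in> T \<and> (\<forall>t\<in>T. G s \<longleftrightarrow> G t)"
      using mono s e(1) by (intro exI[of _ "ball s e \<inter> {0..1}"])
        (auto simp: Int_commute[of "ball s e"] intro!: openin_open_Int)
  qed auto
  moreover have "G 0"
    unfolding G_def word_arc_def
  proof (intro exI conjI)
    show "homotopic_paths (wedge n) (subpath 0 0 \<gamma>) (word_loop [] +++ seg k 0 0)"
      using homotopic_paths_sym[OF homotopic_paths_lid'[of "linepath 0 0" "wedge n" 0]] \<open>0 \<in> wedge n\<close>
      by (simp add: subpath_refl seg_def linepath_refl o_def path_image_const path_def pathstart_def)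
  qed (use k in auto)
  ultimately show ?thesis by (simp add: G_def)
qed

text \<open>The remaining arc ends at 0, so it is either constant or one full turn, which is
  absorbed as one more letter.\<close>

lemma loop_homotopic_word_loop:
  assumes "based_loop (wedge n) 0 \<gamma>"
  obtains w where "set w \<subseteq> letters n" "homotopic_paths (wedge n) \<gamma> (word_loop w)"
proof -
  let ?h = "homotopic_paths (wedge n)"
  obtain w k a where w: "set w \<subseteq> letters n" "k \<in> {1..n}" "0 \<le> a" "a \<le> 2 * pi"
    "?h \<gamma> (word_loop w +++ seg k 0 a)"
    using word_arc_path assms unfolding based_loop_def word_arc_def by blast
  have im: "path_image (word_loop w) \<subseteq> wedge n"
    using w path_image_word_loop zero_in_wedge by blast
  have "circ k a = 0"
    using homotopic_paths_imp_pathfinish[OF w(5)] assms by (simp add: based_loop_def)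
  then consider "a = 0" | "a = 2 * pi"
    using circ_eq_0_iff w by auto
  then show ?thesis
  proof cases
    case 1
    then have "seg k 0 a = linepath 0 0"
      by (auto simp: seg_def linepath_def fun_eq_iff)
    then have "?h (word_loop w +++ seg k 0 a) (word_loop w)"
      using im by (auto intro: homotopic_paths_rid')
    then show ?thesis
      using that w homotopic_paths_trans by blast
  next
    case 2
    have "?h (word_loop w +++ seg k 0 a) (word_loop w +++ word_loop [(k, True)])"
      using 2 im w(2) homotopic_paths_sym[OF word_loop_single[of "(k, True)" n]]
      by (intro homotopic_paths_join_right) (auto simp: letter_loop_def letters_def)
    also have "?h \<dots> (word_loop (w @ [(k, True)]))"
      using w zero_in_wedge[OF w(2)] by (intro homotopic_paths_sym[OF word_loop_append]) (auto simp: letters_def)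
    finally show ?thesis
      using that[of "w @ [(k, True)]"] w(1,2) homotopic_paths_trans[OF w(5)] by (auto simp: letters_def)
  qed
qed

subsection \<open>Finite coverings of the wedge\<close>

lemma continuous_on_finite_closed_cover:
  assumes "finite I" "\<And>i. i \<in> I \<Longrightarrow> closedin (top_of_set T) (C i)" "T \<subseteq> (\<Union>i\<in>I. C i)"
    and "\<And>i. i \<in> I \<Longrightarrow> continuous_on (C i) (f i)" "\<And>i z. i \<in> I \<Longrightarrow> z \<in> C i \<Longrightarrow> g z = f i z"
  shows "continuous_on T g"
proof -
  have "continuous_map (top_of_set T) euclidean g"
  proof (rule pasting_lemma_closed[OF assms(1,2)])
    fix i
    show "continuous_map (subtopology (top_of_set T) (C i)) euclidean (f i)" if i: "i \<in> I"
    proof -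
      have "T \<inter> C i = C i"
        using assms(2)[OF i] closedin_imp_subset by blast
      then show ?thesis
        using assms(4)[OF i] by (simp add: subtopology_subtopology)
    qed
    show "f i z = f j z" if "i \<in> I" "j \<in> I" "z \<in> topspace (top_of_set T) \<inter> C i \<inter> C j" for j z
      using assms(5)[of i z] assms(5)[of j z] that by simp
    show "\<exists>j. j \<in> I \<and> z \<in> C j \<and> g z = f j z" if "z \<in> topspace (top_of_set T)" for z
    proof -
      from that obtain j where "j \<in> I" "z \<in> C j" using assms(3) by auto
      then show ?thesis using assms(5) by blast
    qed
  qed
  then show ?thesis by simp
qed

text \<open>The sheets are the graphs of finitely many sections with pairwise different values. Each
  is closed in the preimage of \<open>T\<close>, as the zero set of
  \<open>snd p - \<sigma> j (fst p)\<close>; since there are finitely many, each is also open, as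
  the complement of the others.\<close>

lemma evenly_covered_graphs:
  fixes E :: "('a::topological_space \<times> 'b::real_normed_vector) set"
  assumes T: "openin (top_of_set S) T" and E: "fst ` E \<subseteq> S" and J: "finite J"
    and cont: "\<And>j. j \<in> J \<Longrightarrow> continuous_on T (\<sigma> j)"
    and inj: "\<And>i j z. \<lbrakk>i \<in> J; j \<in> J; z \<in> T; \<sigma> i z = \<sigma> j z\<rbrakk> \<Longrightarrow> i = j"
    and fibre: "E \<inter> fst -` T = (\<Union>j\<in>J. (\<lambda>z. (z, \<sigma> j z)) ` T)"
  shows "\<exists>v. \<Union>v = E \<inter> fst -` T \<and> (\<forall>u\<in>v. openin (top_of_set E) u) \<and> pairwise disjnt v \<and>
           (\<forall>u\<in>v. \<exists>q. homeomorphism u T fst q)"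
proof -
  define G where "G j = (\<lambda>z. (z, \<sigma> j z)) ` T" for j
  let ?E = "E \<inter> fst -` T"
  have open_E: "openin (top_of_set E) ?E"
    using continuous_openin_preimage[OF continuous_on_fst[OF continuous_on_id] _ T, of E] E by auto
  have disj: "disjnt (G i) (G j)" if "i \<in> J" "j \<in> J" "i \<noteq> j" for i j
    using inj that by (auto simp: G_def disjnt_def)
  have closed: "closedin (top_of_set ?E) (G j)" if j: "j \<in> J" for j
  proof -
    have "continuous_on ?E (\<lambda>p. snd p - \<sigma> j (fst p))"
      by (intro continuous_intros continuous_on_compose2[OF cont[OF j]]) auto
    then have "closedin (top_of_set ?E) {p \<in> ?E. snd p - \<sigma> j (fst p) = 0}"
      by (rule continuous_closedin_preimage_constant)
    moreover have "{p \<in> ?E. snd p - \<sigma> j (fst p) = 0} = G j"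
      using fibre j by (force simp: G_def)
    ultimately show ?thesis by simp
  qed
  have "openin (top_of_set E) (G j)" if j: "j \<in> J" for j
  proof -
    have "G j = ?E - (\<Union>i\<in>J - {j}. G i)"
      using fibre disj j unfolding G_def[symmetric] by (auto simp: disjnt_def)
    moreover have "closedin (top_of_set ?E) (\<Union>i\<in>J - {j}. G i)"
      using J closed by (intro closedin_Union) auto
    ultimately have "openin (top_of_set ?E) (G j)"
      by (metis openin_diff openin_subtopology_self)
    then show ?thesis using open_E openin_trans by blast
  qed
  moreover have "homeomorphism (G j) T fst (\<lambda>z. (z, \<sigma> j z))" if "j \<in> J" for j
    using cont[OF that] by (auto simp: homeomorphism_def G_def image_image intro!: continuous_intros)
  ultimately show ?thesis
    using fibre disj unfolding G_def[symmetric]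
    by (intro exI[of _ "G ` J"]) (auto simp only: pairwise_def ball_simps image_iff; metis)
qed

text \<open>The fibre coordinate on an edge from vertex i to vertex j at parameter s; the imaginary part
  keeps the edges over a common circle disjoint.\<close>
definition edge_point :: "real \<Rightarrow> nat \<Rightarrow> nat \<Rightarrow> complex" where
  "edge_point s i j = Complex ((1 - s) * real i + s * real j) (s * (1 - s) * real i)"

text \<open>At \<open>circ k t\<close> this is \<open>(sin (t / 4))\<^sup>2\<close>, which
  runs from 0 to 1 and is continuous off 0; at 0 itself the value is junk.\<close>
definition circle_param :: "complex \<Rightarrow> real" where
  "circle_param z = (1 + Im z / cmod z) / 2"

text \<open>This is the Schreier graph of the permutations: vertices \<open>0..m\<close> over the
  wedge point and, over circle \<open>k\<close>, an edge from each \<open>j\<close> to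
  \<open>\<rho> k j\<close>. Vertices are listed separately because \<open>circle_param\<close> has
  no meaningful value at 0.\<close>

definition wedge_cover :: "nat \<Rightarrow> nat \<Rightarrow> (nat \<Rightarrow> nat \<Rightarrow> nat) \<Rightarrow> (complex \<times> complex) set" where
  "wedge_cover n m \<rho> = {(0, of_nat j) | j. j \<le> m} \<union>
     {(z, edge_point (circle_param z) j (\<rho> k j)) | z k j. k \<in> {1..n} \<and> z \<in> sphere (of_nat k) (real k) - {0} \<and> j \<le> m}"

lemma edge_point_simps [simp]: "edge_point 0 i j = of_nat i" "edge_point 1 i j = of_nat j"
  by (simp_all add: edge_point_def complex_eq_iff)

lemma continuous_on_edge_point:
  "continuous_on A f \<Longrightarrow> continuous_on A (\<lambda>z. edge_point (f z) i j)"
  unfolding edge_point_def Complex_eq by (intro continuous_intros)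

lemma edge_point_inj:
  assumes "0 < s" "s < 1" "edge_point s i j = edge_point s i' j'"
  shows "i = i'" "j = j'"
  using assms by (auto simp: edge_point_def)

text \<open>On circle \<open>k\<close> the cosine of the argument of \<open>z\<close> is
  \<open>cmod z / (2 * k)\<close>; the claim is the Pythagorean identity for its sine
  \<open>Im z / cmod z\<close>.\<close>

lemma circle_polar:
  fixes z :: complex
  assumes "z \<in> sphere (of_nat k) (real k)" "z \<noteq> 0"
  shows "(Im z / cmod z)\<^sup>2 = 1 - (cmod z / (2 * real k))\<^sup>2" "k \<noteq> 0"
proof -
  have k: "(cmod z)\<^sup>2 = 2 * real k * Re z"
    using assms(1) unfolding sphere_circle_iff .
  show "k \<noteq> 0" using k assms(2) by (cases "k = 0") auto
  then have "Re z = (cmod z)\<^sup>2 / (2 * real k)"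
    using k by simp
  moreover have "(Im z)\<^sup>2 = (cmod z)\<^sup>2 - (Re z)\<^sup>2"
    by (simp add: cmod_power2)
  ultimately show "(Im z / cmod z)\<^sup>2 = 1 - (cmod z / (2 * real k))\<^sup>2"
    using assms(2) by (simp add: power_divide diff_divide_distrib power2_eq_square)
qed

lemma circle_param_bounds:
  assumes "z \<in> sphere (of_nat k) (real k)" "z \<noteq> 0"
  shows "0 < circle_param z" "circle_param z < 1"
proof -
  have "(Im z / cmod z)\<^sup>2 < 1"
    using circle_polar[OF assms] assms(2) by simp
  then have "\<bar>Im z / cmod z\<bar> < 1"
    using abs_square_less_1 by blast
  moreover have "0 < (1 + x) / 2 \<and> (1 + x) / 2 < 1" if "\<bar>x\<bar> < 1" for x :: real
    using that by auto
  ultimately show "0 < circle_param z" "circle_param z < 1"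
    unfolding circle_param_def by blast+
qed

text \<open>On each open half circle the parameter depends on the modulus alone, and these formulas,
  unlike \<open>circle_param\<close>, extend continuously to \<open>z = 0\<close>, with the values 0
  below the real axis and 1 above it.\<close>

lemma circle_param_eq_sqrt:
  assumes "z \<in> sphere (of_nat k) (real k)" "z \<noteq> 0"
  shows "Im z < 0 \<Longrightarrow> circle_param z = (1 - sqrt (1 - (cmod z / (2 * real k))\<^sup>2)) / 2"
    and "0 < Im z \<Longrightarrow> circle_param z = (1 + sqrt (1 - (cmod z / (2 * real k))\<^sup>2)) / 2"
  unfolding circle_polar(1)[OF assms, symmetric] circle_param_def
  using assms(2) by (auto simp: abs_if divide_less_0_iff)

lemma circle_param_circ:
  assumes "k \<ge> 1" "0 < t" "t < 2 * pi"
  shows "circle_param (circ k t) = (sin (t / 4))\<^sup>2"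
proof -
  have s: "sin (t / 2) > 0" using assms by (intro sin_gt_zero) auto
  have "(cmod (circ k t))\<^sup>2 = (2 * real k * sin (t / 2))\<^sup>2"
  proof -
    have c: "cos t = 1 - 2 * (sin (t / 2))\<^sup>2" and "(sin t)\<^sup>2 = 1 - (cos t)\<^sup>2"
      using cos_double_sin[of "t / 2"] by (simp_all add: sin_squared_eq)
    then have "(real k * (1 - cos t))\<^sup>2 + (- real k * sin t)\<^sup>2 = (real k)\<^sup>2 * (2 * (1 - cos t))"
      unfolding power_mult_distrib power2_minus \<open>(sin t)\<^sup>2 = _\<close> by (simp add: power2_eq_square algebra_simps)
    also have "\<dots> = (2 * real k * sin (t / 2))\<^sup>2"
      unfolding c by (simp add: power_mult_distrib)
    finally show ?thesis unfolding cmod_power2 Re_circ Im_circ .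
  qed
  then have "cmod (circ k t) = 2 * real k * sin (t / 2)"
    using s by (simp add: power2_eq_iff_nonneg)
  moreover have "Im (circ k t) = - (2 * real k * sin (t / 2)) * cos (t / 2)"
    using sin_double[of "t / 2"] by (simp add: Im_circ)
  ultimately have "Im (circ k t) / cmod (circ k t) = - cos (t / 2)"
    using s assms(1) by simp
  moreover have "cos (t / 2) = 1 - 2 * (sin (t / 4))\<^sup>2"
    using cos_double_sin[of "t / 4"] by simp
  ultimately show ?thesis by (simp add: circle_param_def)
qed

lemma wedge_cover_fibre:
  assumes "k \<in> {1..n}" "z \<in> sphere (of_nat k) (real k) - {0}"
  shows "(z, v) \<in> wedge_cover n m \<rho> \<longleftrightarrow> (\<exists>j\<le>m. v = edge_point (circle_param z) j (\<rho> k j))"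
  using assms sphere_circle_unique[of z k] unfolding wedge_cover_def by blast

lemma wedge_cover_fibre_0: "(0, v) \<in> wedge_cover n m \<rho> \<longleftrightarrow> (\<exists>j\<le>m. v = of_nat j)"
  unfolding wedge_cover_def by blast

definition circle_index :: "complex \<Rightarrow> nat" where
  "circle_index z = (SOME k. z \<in> sphere (of_nat k) (real k))"

lemma circle_index_eq: "z \<in> sphere (of_nat k) (real k) - {0} \<Longrightarrow> circle_index z = k"
  unfolding circle_index_def using sphere_circle_unique[of z _ k] by (intro some_equality) auto

text \<open>Away from 0 the sheets are indexed by the start vertex of the edge. The index lookup is
  continuous because each punctured circle is closed in the punctured wedge.\<close>

lemma evenly_covered_punctured:
  fixes n m :: nat and \<rho> :: "nat \<Rightarrow> nat \<Rightarrow> nat"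
  defines "E \<equiv> wedge_cover n m \<rho>" and "T \<equiv> wedge n - {0}"
  assumes E: "fst ` E \<subseteq> wedge n"
  shows "\<exists>v. \<Union>v = E \<inter> fst -` T \<and> (\<forall>u\<in>v. openin (top_of_set E) u) \<and> pairwise disjnt v \<and>
           (\<forall>u\<in>v. \<exists>q. homeomorphism u T fst q)"
proof (rule evenly_covered_graphs[where J = "{..m}" and \<sigma> = "\<lambda>j z. edge_point (circle_param z) j (\<rho> (circle_index z) j)"])
  show "openin (top_of_set (wedge n)) T"
    unfolding T_def by (simp add: openin_delete)
  show "fst ` E \<subseteq> wedge n" by fact
  have TE: "\<exists>k\<in>{1..n}. z \<in> sphere (of_nat k) (real k) - {0}" if "z \<in> T" for z
    using that unfolding T_def wedge_def by blast
  show "i = j" if z: "z \<in> T" and eq: "edge_point (circle_param z) i (\<rho> (circle_index z) i) = edge_point (circle_param z) j (\<rho> (circle_index z) j)" for i j and z :: complex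
  proof -
    obtain k where "z \<in> sphere (of_nat k) (real k)" "z \<noteq> 0" using TE[OF z] by blast
    then show ?thesis using edge_point_inj(1)[OF circle_param_bounds eq] by blast
  qed
  show "E \<inter> fst -` T = (\<Union>j\<in>{..m}. (\<lambda>z. (z, edge_point (circle_param z) j (\<rho> (circle_index z) j))) ` T)" (is "?L = ?R")
  proof (rule set_eqI)
    fix p :: "complex \<times> complex"
    obtain z v where [simp]: "p = (z, v)" by fastforce
    show "p \<in> ?L \<longleftrightarrow> p \<in> ?R"
    proof (cases "z \<in> T")
      case True
      then obtain k where k: "k \<in> {1..n}" "z \<in> sphere (of_nat k) (real k) - {0}" using TE by blast
      show ?thesis
        using True wedge_cover_fibre[OF k, of v m \<rho>] circle_index_eq[OF k(2)] unfolding E_def by auto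
    qed auto
  qed
  show "continuous_on T (\<lambda>z. edge_point (circle_param z) j (\<rho> (circle_index z) j))" for j
  proof (rule continuous_on_finite_closed_cover[where I = "{1..n}" and C = "\<lambda>k. sphere (of_nat k) (real k) - {0}"
        and f = "\<lambda>k z. edge_point (circle_param z) j (\<rho> k j)"])
    fix k assume k: "k \<in> {1..n}"
    have "sphere (of_nat k) (real k) - {0} = T \<inter> sphere (of_nat k) (real k)"
      using k unfolding T_def wedge_def by blast
    then show "closedin (top_of_set T) (sphere (of_nat k) (real k) - {0})"
      by (simp add: closedin_closed_Int)
    show "continuous_on (sphere (of_nat k) (real k) - {0}) (\<lambda>z. edge_point (circle_param z) j (\<rho> k j))"
      unfolding circle_param_def by (intro continuous_on_edge_point continuous_intros) auto
  next
    show "T \<subseteq> (\<Union>k\<in>{1..n}. sphere (of_nat k) (real k) - {0})" using TE by blast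
  qed (use circle_index_eq in auto)
qed auto

text \<open>Here sheet \<open>j\<close> is the neighbourhood of vertex \<open>j\<close>: the
  beginnings of its outgoing edges over the lower half circles, where \<open>circ\<close> starts,
  and the ends of its incoming edges, starting at \<open>inv (\<rho> k) j\<close>, over the upper
  ones.\<close>

lemma evenly_covered_star:
  fixes n m :: nat
  assumes \<rho>: "\<And>k. \<rho> k permutes {..m}"
  defines "E \<equiv> wedge_cover n m \<rho>"
  assumes E: "fst ` E \<subseteq> wedge n"
  shows "\<exists>v. \<Union>v = E \<inter> fst -` star n \<and> (\<forall>u\<in>v. openin (top_of_set E) u) \<and> pairwise disjnt v \<and>
           (\<forall>u\<in>v. \<exists>q. homeomorphism u (star n) fst q)"
proof -
  define \<sigma> where "\<sigma> j z = (if z = 0 then of_nat j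
    else if Im z < 0 then edge_point (circle_param z) j (\<rho> (circle_index z) j)
    else edge_point (circle_param z) (inv (\<rho> (circle_index z)) j) j)" for j z
  have inv_le: "inv (\<rho> k) j \<le> m \<longleftrightarrow> j \<le> m" and \<rho>_le: "\<rho> k j \<le> m \<longleftrightarrow> j \<le> m"
    and inv_\<rho>: "inv (\<rho> k) (\<rho> k j) = j" "\<rho> k (inv (\<rho> k) j) = j" for k j
    using permutes_in_image[OF permutes_inv[OF \<rho>]] permutes_in_image[OF \<rho>] permutes_inverses[OF \<rho>] by auto
  have starE: "\<exists>k\<in>{1..n}. z \<in> sphere (of_nat k) (real k) - {0}" if "z \<in> star n" "z \<noteq> 0" for z
    using that unfolding star_def wedge_def by blast
  show ?thesis
  proof (rule evenly_covered_graphs[OF openin_star E, where J = "{..m}" and \<sigma> = \<sigma>])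
    show "i = j" if z: "z \<in> star n" and eq: "\<sigma> i z = \<sigma> j z" for i j and z :: complex
    proof (cases "z = 0")
      case True
      then show ?thesis using eq by (simp add: \<sigma>_def)
    next
      case False
      then obtain k where k: "z \<in> sphere (of_nat k) (real k)" using starE[OF z False] by blast
      note bounds = circle_param_bounds[OF this False]
      then show ?thesis
        using eq False edge_point_inj[OF bounds] unfolding \<sigma>_def by (auto split: if_splits)
    qed
    show "E \<inter> fst -` star n = (\<Union>j\<in>{..m}. (\<lambda>z. (z, \<sigma> j z)) ` star n)" (is "?L = ?R")
    proof (rule set_eqI)
      fix p :: "complex \<times> complex"
      obtain z v where [simp]: "p = (z, v)" by fastforce
      have "(z, v) \<in> E \<longleftrightarrow> (\<exists>j\<le>m. v = \<sigma> j z)" if z: "z \<in> star n"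
      proof (cases "z = 0")
        case True
        then show ?thesis using wedge_cover_fibre_0 unfolding E_def \<sigma>_def by simp
      next
        case False
        then obtain k where k: "k \<in> {1..n}" "z \<in> sphere (of_nat k) (real k) - {0}" using starE z by blast
        note * = wedge_cover_fibre[OF k, of v m \<rho>]
        show ?thesis
        proof (cases "Im z < 0")
          case True
          then show ?thesis using * False circle_index_eq[OF k(2)] unfolding E_def \<sigma>_def by simp
        next
          case im: False
          have "(\<exists>j\<le>m. v = edge_point (circle_param z) j (\<rho> k j)) \<longleftrightarrow>
            (\<exists>j\<le>m. v = edge_point (circle_param z) (inv (\<rho> k) j) j)"
            by (metis inv_le inv_\<rho>)
          then show ?thesis using * im False circle_index_eq[OF k(2)] unfolding E_def \<sigma>_def by simp
        qed
      qed
      then show "p \<in> ?L \<longleftrightarrow> p \<in> ?R" by auto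
    qed
    show "continuous_on (star n) (\<sigma> j)" for j
    \<comment> \<open>The closed half circles within the star are pasted at 0. On each, the
      square-root formula replaces \<open>circle_param\<close>, so continuity includes the point 0,
      where both formulas give the vertex \<open>j\<close>.\<close>
    proof (rule continuous_on_finite_closed_cover[where I = "{1..n} \<times> UNIV"
        and C = "\<lambda>(k, b). {z \<in> star n. z \<in> sphere (of_nat k) (real k) \<and> (if b then 0 \<le> Im z else Im z \<le> 0)}"
        and f = "\<lambda>(k, b) z. if b then edge_point ((1 + sqrt (1 - (cmod z / (2 * real k))\<^sup>2)) / 2) (inv (\<rho> k) j) j
                   else edge_point ((1 - sqrt (1 - (cmod z / (2 * real k))\<^sup>2)) / 2) j (\<rho> k j)"];
        (clarify | simp only: prod.case)?)
      fix k and b :: bool assume k: "k \<in> {1..n}"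
      have *: "{z \<in> star n. z \<in> sphere (of_nat k) (real k) \<and> (if b then 0 \<le> Im z else Im z \<le> 0)} =
          star n \<inter> (sphere (of_nat k) (real k) \<inter> (if b then {z. 0 \<le> Im z} else {z. Im z \<le> 0}))"
        by auto
      show "closedin (top_of_set (star n)) {z \<in> star n. z \<in> sphere (of_nat k) (real k) \<and> (if b then 0 \<le> Im z else Im z \<le> 0)}"
        unfolding * using closed_halfspace_Im_ge[of 0] closed_halfspace_Im_le[of 0]
        by (intro closedin_closed_Int closed_Int) auto
      show "continuous_on {z \<in> star n. z \<in> sphere (of_nat k) (real k) \<and> (if b then 0 \<le> Im z else Im z \<le> 0)}
          (\<lambda>z. if b then edge_point ((1 + sqrt (1 - (cmod z / (2 * real k))\<^sup>2)) / 2) (inv (\<rho> k) j) j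
                   else edge_point ((1 - sqrt (1 - (cmod z / (2 * real k))\<^sup>2)) / 2) j (\<rho> k j))"
        using k by (cases b; simp only: if_True if_False; intro continuous_on_edge_point continuous_intros; simp)
      fix z assume z: "z \<in> star n" "z \<in> sphere (of_nat k) (real k)" "if b then 0 \<le> Im z else Im z \<le> 0"
      show "\<sigma> j z = (if b then edge_point ((1 + sqrt (1 - (cmod z / (2 * real k))\<^sup>2)) / 2) (inv (\<rho> k) j) j
                   else edge_point ((1 - sqrt (1 - (cmod z / (2 * real k))\<^sup>2)) / 2) j (\<rho> k j))"
      proof (cases "z = 0")
        case True
        then show ?thesis by (simp add: \<sigma>_def)
      next
        case False
        then have "Im z \<noteq> 0" "circle_index z = k"
          using z circle_index_eq by (auto simp: star_def)
        show ?thesis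
        proof (cases b)
          case True
          then have "0 < Im z" using z(3) \<open>Im z \<noteq> 0\<close> by simp
          then show ?thesis
            using True False \<open>circle_index z = k\<close> unfolding \<sigma>_def circle_param_eq_sqrt(2)[OF z(2) False \<open>0 < Im z\<close>]
            by simp
        next
          case b: False
          then have "Im z < 0" using z(3) \<open>Im z \<noteq> 0\<close> by simp
          then show ?thesis
            using b False \<open>circle_index z = k\<close> unfolding \<sigma>_def circle_param_eq_sqrt(1)[OF z(2) False \<open>Im z < 0\<close>]
            by simp
        qed
      qed
    next
      fix z assume z: "z \<in> star n"
      then obtain k where "k \<in> {1..n}" "z \<in> sphere (of_nat k) (real k)"
        unfolding star_def wedge_def by blast
      then show "z \<in> (\<Union>i\<in>{1..n} \<times> UNIV. case i of (k, b) \<Rightarrow>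
          {z \<in> star n. z \<in> sphere (of_nat k) (real k) \<and> (if b then 0 \<le> Im z else Im z \<le> 0)})"
        using z by (intro UN_I[of "(k, 0 \<le> Im z)"]) auto
    qed auto
  qed auto
qed

lemma covering_space_wedge_cover:
  fixes n m :: nat
  assumes \<rho>: "\<And>k. \<rho> k permutes {..m}" and n: "n \<ge> 1"
  shows "covering_space (wedge_cover n m \<rho>) fst (wedge n)"
  unfolding covering_space_def
proof (intro conjI ballI)
  let ?E = "wedge_cover n m \<rho>"
  show "continuous_on ?E fst" by (intro continuous_intros)
  have 0: "0 \<in> wedge n" using n zero_in_wedge[of 1 n] by simp
  then have sub: "fst ` ?E \<subseteq> wedge n"
    unfolding wedge_cover_def wedge_def by auto
  moreover have "z \<in> fst ` ?E" if z: "z \<in> wedge n" for z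
  proof (cases "z = 0")
    case True
    then show ?thesis using wedge_cover_fibre_0[of 0 n m \<rho>] by force
  next
    case False
    obtain k where "k \<in> {1..n}" "z \<in> sphere (of_nat k) (real k)" using z by (rule wedge_sphereE)
    then have "(z, edge_point (circle_param z) 0 (\<rho> k 0)) \<in> ?E"
      using wedge_cover_fibre[of k n z] False by blast
    then show ?thesis by force
  qed
  ultimately show "fst ` ?E = wedge n" by blast
  fix z assume z: "z \<in> wedge n"
  show "\<exists>T. z \<in> T \<and> openin (top_of_set (wedge n)) T \<and>
      (\<exists>v. \<Union>v = ?E \<inter> fst -` T \<and> (\<forall>u\<in>v. openin (top_of_set ?E) u) \<and> pairwise disjnt v \<and>
        (\<forall>u\<in>v. \<exists>q. homeomorphism u T fst q))"
  proof (cases "z = 0")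
    case True
    then show ?thesis
      using evenly_covered_star[OF \<rho> sub] openin_star 0 by (intro exI[of _ "star n"]) (auto simp: star_def)
  next
    case False
    then show ?thesis
      using evenly_covered_punctured[OF sub] z
      by (intro exI[of _ "wedge n - {0}"]) (auto simp: openin_delete)
  qed
qed

text \<open>A letter lifts to the edge leaving the current vertex, or, if inverted, to the reversal
  of the edge arriving there; so the end of the lift computes the action of the word.\<close>

lemma lift_word_loop:
  fixes m :: nat
  assumes \<rho>: "\<And>k. \<rho> k permutes {..m}" and w: "set w \<subseteq> letters n" and j: "j \<le> m"
  shows "\<exists>h. path h \<and> path_image h \<subseteq> wedge_cover n m \<rho> \<and> fst \<circ> h = word_loop w \<and>
     pathstart h = (0, of_nat j) \<and> pathfinish h = (0, of_nat (word_act \<rho> w j))"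
  using w j
proof (induction w arbitrary: j)
  case Nil
  then show ?case
    using wedge_cover_fibre_0 by (intro exI[of _ "\<lambda>_. (0, of_nat j)"])
      (auto simp: path_def pathstart_def pathfinish_def path_image_def linepath_def fun_eq_iff)
next
  case (Cons x w)
  have fwd: "\<exists>h. path h \<and> path_image h \<subseteq> wedge_cover n m \<rho> \<and> fst \<circ> h = seg k 0 (2 * pi) \<and>
     pathstart h = (0, of_nat i) \<and> pathfinish h = (0, of_nat (\<rho> k i))"
    if k: "k \<in> {1..n}" and i: "i \<le> m" for k i
  proof (intro exI conjI)
    \<comment> \<open>The squared sine is \<open>circle_param\<close> at \<open>circ k t\<close>
      with \<open>t = 2 * pi * u\<close>. Written out, it also has the right values 0 and 1 at the
      ends, where \<open>circle_param\<close> itself fails.\<close>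
    define h where "h u = (circ k (2 * pi * u), edge_point ((sin (pi * u / 2))\<^sup>2) i (\<rho> k i))" for u
    show "path h"
      unfolding path_def h_def
      by (intro continuous_on_Pair continuous_on_edge_point continuous_intros continuous_on_compose2[OF continuous_on_circ[of UNIV]]) auto
    have "h u \<in> wedge_cover n m \<rho>" if "0 \<le> u" "u \<le> 1" for u
    proof (cases "u = 0 \<or> u = 1")
      case True
      moreover have "\<rho> k i \<le> m" using permutes_in_image[OF \<rho>[of k], of i] i by simp
      ultimately show ?thesis using wedge_cover_fibre_0 i by (auto simp: h_def)
    next
      case False
      then have u: "0 < 2 * pi * u" "2 * pi * u < 2 * pi" using that by auto
      then have "circ k (2 * pi * u) \<in> sphere (of_nat k) (real k) - {0}"
        using circ_in_sphere[of k] circ_eq_0_iff[of k "2 * pi * u"] k by (auto simp del: mem_sphere)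
      moreover have "circle_param (circ k (2 * pi * u)) = (sin (pi * u / 2))\<^sup>2"
        using circle_param_circ[of k "2 * pi * u"] k u by simp
      ultimately show ?thesis
        unfolding h_def using wedge_cover_fibre[OF k] i by metis
    qed
    then show "path_image h \<subseteq> wedge_cover n m \<rho>" by (auto simp: path_image_def)
    show "fst \<circ> h = seg k 0 (2 * pi)"
      by (auto simp: h_def seg_def linepath_def fun_eq_iff mult.commute)
    show "pathstart h = (0, of_nat i)" "pathfinish h = (0, of_nat (\<rho> k i))"
      by (simp_all add: h_def pathstart_def pathfinish_def)
  qed
  obtain k b where x: "x = (k, b)" "k \<in> {1..n}" using Cons.prems by (cases x) (auto simp: letters_def)
  have act_le: "letter_act \<rho> x j \<le> m"
    using permutes_in_image[OF letter_act_permutes[of \<rho> "{..m}" x, OF \<rho>], of j] Cons.prems(2) by simp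
  have "\<exists>h. path h \<and> path_image h \<subseteq> wedge_cover n m \<rho> \<and> fst \<circ> h = letter_loop x \<and>
     pathstart h = (0, of_nat j) \<and> pathfinish h = (0, of_nat (letter_act \<rho> x j))"
  proof (cases b)
    case True
    then show ?thesis using fwd[OF x(2) Cons.prems(2)] x by (simp add: letter_loop_def letter_act_def)
  next
    case False
    then have act: "letter_act \<rho> x j = inv (\<rho> k) j" using x by (simp add: letter_act_def)
    obtain h where "path h" "path_image h \<subseteq> wedge_cover n m \<rho>" "fst \<circ> h = seg k 0 (2 * pi)"
     "pathstart h = (0, of_nat (inv (\<rho> k) j))" "pathfinish h = (0, of_nat j)"
      using fwd[OF x(2) act_le] permutes_inverses(1)[OF \<rho>] unfolding act by metis
    then show ?thesis
      using False x act by (intro exI[of _ "reversepath h"])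
        (auto simp: letter_loop_def path_compose_reversepath reversepath_seg)
  qed
  then obtain h where h: "path h" "path_image h \<subseteq> wedge_cover n m \<rho>" "fst \<circ> h = letter_loop x"
     "pathstart h = (0, of_nat j)" "pathfinish h = (0, of_nat (letter_act \<rho> x j))" by blast
  obtain h' where h': "path h'" "path_image h' \<subseteq> wedge_cover n m \<rho>" "fst \<circ> h' = word_loop w"
     "pathstart h' = (0, of_nat (letter_act \<rho> x j))" "pathfinish h' = (0, of_nat (word_act \<rho> w (letter_act \<rho> x j)))"
    using Cons.IH[OF _ act_le] Cons.prems(1) by (meson order_trans set_subset_Cons)
  show ?case
    using h h' by (intro exI[of _ "h +++ h'"]) (auto simp: path_compose_join path_image_join)
qed

text \<open>Monodromy: lifts of homotopic loops from the same vertex end at the same vertex. Thus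
  every tuple of permutations defines a homomorphism on homotopy classes, with no presentation of
  the fundamental group.\<close>

lemma word_act_homotopy_invariant:
  fixes m :: nat
  assumes \<rho>: "\<And>k. \<rho> k permutes {..m}" and w: "set w \<subseteq> letters n" "set w' \<subseteq> letters n"
    and hom: "homotopic_paths (wedge n) (word_loop w) (word_loop w')"
  shows "word_act \<rho> w = word_act \<rho> w'"
proof
  fix j
  have "0 \<in> wedge n"
    using homotopic_paths_imp_subset[OF hom] pathstart_in_path_image[of "word_loop w"] by auto
  then have n: "n \<ge> 1" by (auto simp: wedge_def)
  show "word_act \<rho> w j = word_act \<rho> w' j"
  proof (cases "j \<le> m")
    case True
    obtain h where h: "path h" "path_image h \<subseteq> wedge_cover n m \<rho>" "fst \<circ> h = word_loop w"
     "pathstart h = (0, of_nat j)" "pathfinish h = (0, of_nat (word_act \<rho> w j))"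
      using lift_word_loop[of \<rho> m w n j, OF \<rho> w(1) True] by blast
    obtain h' where h': "path h'" "path_image h' \<subseteq> wedge_cover n m \<rho>" "fst \<circ> h' = word_loop w'"
     "pathstart h' = (0, of_nat j)" "pathfinish h' = (0, of_nat (word_act \<rho> w' j))"
      using lift_word_loop[of \<rho> m w' n j, OF \<rho> w(2) True] by blast
    have "pathfinish h = pathfinish h'"
    proof (rule covering_space_monodromy[OF covering_space_wedge_cover[of \<rho> m n, OF \<rho> n]])
      show "fst (h t) = word_loop w t" for t using h(3) by (metis comp_apply)
      show "fst (h' t) = word_loop w' t" for t using h'(3) by (metis comp_apply)
    qed (use h h' hom homotopic_paths_imp_subset[OF hom] in auto)
    then show ?thesis using h h' by simp
  next
    case False
    then show ?thesis
      using permutes_not_in[OF word_act_permutes[of \<rho> "{..m}" w, OF \<rho>]] permutes_not_in[OF word_act_permutes[of \<rho> "{..m}" w', OF \<rho>]] by simp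
  qed
qed

subsection \<open>The Hopf property of the fundamental group\<close>

text \<open>Keeping both endpoints in one predicate lets the side conditions of the homotopy rules
  be discharged by resolution with rules for joins and reversals.\<close>

definition path_in :: "'a::topological_space set \<Rightarrow> 'a \<Rightarrow> 'a \<Rightarrow> (real \<Rightarrow> 'a) \<Rightarrow> bool" where
  "path_in S a b p \<longleftrightarrow> path p \<and> path_image p \<subseteq> S \<and> pathstart p = a \<and> pathfinish p = b"

text \<open>The change-of-base-point isomorphism along \<open>l\<close>, from loops at the end of
  \<open>l\<close> to loops at its start.\<close>

definition conj_path :: "(real \<Rightarrow> 'a::topological_space) \<Rightarrow> (real \<Rightarrow> 'a) \<Rightarrow> real \<Rightarrow> 'a" where
  "conj_path l p = l +++ (p +++ reversepath l)"

lemma based_loop_iff_path_in: "based_loop S x \<gamma> \<longleftrightarrow> path_in S x x \<gamma>"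
  by (simp add: based_loop_def path_in_def)

lemma path_in_join: "path_in S a b p \<Longrightarrow> path_in S b c q \<Longrightarrow> path_in S a c (p +++ q)"
  by (auto simp: path_in_def path_image_join)

lemma path_in_reversepath: "path_in S a b p \<Longrightarrow> path_in S b a (reversepath p)"
  by (auto simp: path_in_def)

lemma path_in_const: "a \<in> S \<Longrightarrow> path_in S a a (linepath a a)"
  by (auto simp: path_in_def)

lemma path_in_conj: "path_in S a b l \<Longrightarrow> path_in S b b p \<Longrightarrow> path_in S a a (conj_path l p)"
  unfolding conj_path_def by (intro path_in_join path_in_reversepath)

lemma path_in_compose:
  "path_in S a b p \<Longrightarrow> continuous_on S f \<Longrightarrow> f ` S \<subseteq> T \<Longrightarrow> path_in T (f a) (f b) (f \<circ> p)"
  by (auto simp: path_in_def path_image_compose pathstart_compose pathfinish_compose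
      intro!: path_continuous_image continuous_on_subset[of S f])

lemma path_in_start: "path_in S a b p \<Longrightarrow> a \<in> S" and path_in_finish: "path_in S a b p \<Longrightarrow> b \<in> S"
  using pathstart_in_path_image[of p] pathfinish_in_path_image[of p] by (auto simp: path_in_def)

lemma path_in_homotopic: "homotopic_paths S p q \<Longrightarrow> path_in S a b p \<Longrightarrow> path_in S a b q"
  using homotopic_paths_imp_path homotopic_paths_imp_subset homotopic_paths_imp_pathstart
    homotopic_paths_imp_pathfinish unfolding path_in_def by metis

context
  fixes S :: "'a::real_normed_vector set"
begin

abbreviation (input) homotopic_in_S (infix \<open>\<simeq>\<close> 50) where "p \<simeq> q \<equiv> homotopic_paths S p q"

lemma hp_refl: "path_in S a b p \<Longrightarrow> p \<simeq> p"
  by (auto simp: path_in_def)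

lemma hp_assoc:
  "path_in S a b p \<Longrightarrow> path_in S b c q \<Longrightarrow> path_in S c d r \<Longrightarrow> p +++ (q +++ r) \<simeq> (p +++ q) +++ r"
  by (intro homotopic_paths_assoc) (auto simp: path_in_def)

lemma hp_join:
  "p \<simeq> p' \<Longrightarrow> q \<simeq> q' \<Longrightarrow> path_in S a b p \<Longrightarrow> path_in S b c q \<Longrightarrow> p +++ q \<simeq> p' +++ q'"
  by (intro homotopic_paths_join) (auto simp: path_in_def)

lemma hp_cancel:
  assumes "path_in S a b p" "path_in S c b q" "path_in S b d r"
  shows "(p +++ reversepath q) +++ (q +++ r) \<simeq> p +++ r"
proof -
  note ins = path_in_join path_in_reversepath
  have linv: "reversepath q +++ q \<simeq> linepath b b"
    using homotopic_paths_linv[of q S] assms(2) by (auto simp: path_in_def)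
  have lid: "linepath b b +++ r \<simeq> r"
    using homotopic_paths_lid[of r S] assms(3) by (auto simp: path_in_def)
  have "(p +++ reversepath q) +++ (q +++ r) \<simeq> p +++ (reversepath q +++ (q +++ r))"
    by (rule homotopic_paths_sym[OF hp_assoc] ins assms)+
  also have "\<dots> \<simeq> p +++ ((reversepath q +++ q) +++ r)"
    by (rule hp_join[OF hp_refl hp_assoc] ins assms)+
  also have "\<dots> \<simeq> p +++ (linepath b b +++ r)"
    by (rule linv hp_join[OF hp_refl] hp_join[OF _ hp_refl] ins assms)+
  also have "\<dots> \<simeq> p +++ r"
    by (rule lid hp_join[OF hp_refl] ins assms path_in_const path_in_finish[OF assms(1)])+
  finally show ?thesis .
qed

lemma conj_path_cong:
  assumes "p \<simeq> q" "path_in S a b l" "path_in S b b p"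
  shows "conj_path l p \<simeq> conj_path l q"
  unfolding conj_path_def
  by (rule hp_join[OF hp_refl] hp_join[OF assms(1) hp_refl] path_in_join path_in_reversepath assms)+

lemma conj_path_join:
  assumes l: "path_in S a b l" and p: "path_in S b b p" and q: "path_in S b b q"
  shows "conj_path l (p +++ q) \<simeq> conj_path l p +++ conj_path l q"
proof -
  note ins = path_in_join path_in_reversepath l p q
  have "conj_path l p +++ conj_path l q \<simeq> ((l +++ p) +++ reversepath l) +++ (l +++ (q +++ reversepath l))"
    unfolding conj_path_def by (rule hp_join[OF hp_assoc hp_refl] ins)+
  also have "\<dots> \<simeq> (l +++ p) +++ (q +++ reversepath l)"
    by (rule hp_cancel ins)+
  also have "\<dots> \<simeq> l +++ (p +++ (q +++ reversepath l))"
    by (rule homotopic_paths_sym[OF hp_assoc] ins)+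
  also have "\<dots> \<simeq> conj_path l (p +++ q)"
    unfolding conj_path_def by (rule hp_join[OF hp_refl hp_assoc] ins)+
  finally show ?thesis by (rule homotopic_paths_sym)
qed

lemma conj_path_conj_path:
  assumes l: "path_in S a b l" and m: "path_in S b c m" and p: "path_in S c c p"
  shows "conj_path l (conj_path m p) \<simeq> conj_path (l +++ m) p"
proof -
  note ins = path_in_join path_in_reversepath l m p
  have "conj_path l (conj_path m p) \<simeq> l +++ (m +++ ((p +++ reversepath m) +++ reversepath l))"
    unfolding conj_path_def by (rule hp_join[OF hp_refl homotopic_paths_sym[OF hp_assoc]] ins)+
  also have "\<dots> \<simeq> l +++ (m +++ (p +++ (reversepath m +++ reversepath l)))"
    by (rule hp_join[OF hp_refl hp_join[OF hp_refl homotopic_paths_sym[OF hp_assoc]]] ins)+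
  also have "\<dots> \<simeq> (l +++ m) +++ (p +++ (reversepath m +++ reversepath l))"
    by (rule hp_assoc ins)+
  finally show ?thesis
    using l m by (simp add: conj_path_def path_in_def reversepath_joinpaths)
qed

lemma conj_path_const:
  assumes l: "path_in S a b l"
  shows "conj_path l (linepath b b) \<simeq> linepath a a"
proof -
  have lid: "linepath b b +++ reversepath l \<simeq> reversepath l"
    using homotopic_paths_lid[of "reversepath l" S] l by (auto simp: path_in_def)
  have "conj_path l (linepath b b) \<simeq> l +++ reversepath l"
    unfolding conj_path_def
    by (rule lid hp_join[OF hp_refl] path_in_join path_in_const path_in_reversepath l path_in_finish[OF l])+
  also have "\<dots> \<simeq> linepath a a"
    using homotopic_paths_rinv[of l S] l by (auto simp: path_in_def)
  finally show ?thesis .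
qed

lemma const_conj_path:
  assumes p: "path_in S a a p"
  shows "conj_path (linepath a a) p \<simeq> p"
proof -
  note ins = path_in_join path_in_const path_in_start[OF p] p
  have "conj_path (linepath a a) p \<simeq> p +++ linepath a a"
    unfolding conj_path_def reversepath_linepath
    using path_in_join[OF p path_in_const[OF path_in_start[OF p]]]
    by (intro homotopic_paths_lid') (auto simp: path_in_def)
  also have "\<dots> \<simeq> p"
    using p by (intro homotopic_paths_rid') (auto simp: path_in_def)
  finally show ?thesis .
qed

lemma conj_path_inverse:
  assumes l: "path_in S a b l" and p: "path_in S a a p"
  shows "conj_path l (conj_path (reversepath l) p) \<simeq> p"
proof -
  note ins = path_in_join path_in_reversepath l p
  let ?m = "l +++ reversepath l"
  have m: "?m \<simeq> linepath a a"
    using homotopic_paths_rinv[of l S] l by (auto simp: path_in_def)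
  have "conj_path l (conj_path (reversepath l) p) \<simeq> conj_path ?m p"
    by (rule conj_path_conj_path ins)+
  also have "\<dots> \<simeq> conj_path (linepath a a) p"
    unfolding conj_path_def
    by (rule homotopic_paths_reversepath[THEN iffD2, OF m] hp_join[OF m] hp_join[OF hp_refl] ins)+
  also have "\<dots> \<simeq> p"
    by (rule const_conj_path p)+
  finally show ?thesis .
qed

lemma reversepath_conj_path:
  assumes l: "path_in S a b l" and p: "path_in S b b p"
  shows "reversepath (conj_path l p) \<simeq> conj_path l (reversepath p)"
proof -
  note ins = path_in_join path_in_reversepath l p
  have eq: "reversepath (conj_path l p) = (l +++ reversepath p) +++ reversepath l"
    using l p by (simp add: conj_path_def path_in_def reversepath_joinpaths)
  show ?thesis
    unfolding eq unfolding conj_path_def by (rule homotopic_paths_sym[OF hp_assoc] ins)+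
qed

end

lemma conj_path_compose: "f \<circ> conj_path l p = conj_path (f \<circ> l) (f \<circ> p)"
  by (simp add: conj_path_def path_compose_join path_compose_reversepath)

lemma path_in_word_loop: "set w \<subseteq> letters n \<Longrightarrow> 0 \<in> wedge n \<Longrightarrow> path_in (wedge n) 0 0 (word_loop w)"
  by (simp add: path_in_def path_image_word_loop)

lemma path_in_letter_loop: "x \<in> letters n \<Longrightarrow> path_in (wedge n) 0 0 (letter_loop x)"
  by (simp add: path_in_def path_image_letter_loop)

lemma word_loop_word_inv:
  assumes "set w \<subseteq> letters n" "0 \<in> wedge n"
  shows "homotopic_paths (wedge n) (word_loop (word_inv w)) (reversepath (word_loop w))"
  using assms(1)
proof (induction w)
  case Nil
  show ?case
    unfolding word_inv_simps word_loop.simps reversepath_linepath by (rule hp_refl[OF path_in_const[OF assms(2)]])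
next
  case (Cons x w)
  let ?h = "homotopic_paths (wedge n)"
  have x: "x \<in> letters n" and w: "set w \<subseteq> letters n" "set (word_inv w) \<subseteq> letters n" using Cons.prems by auto
  have "?h (word_loop (word_inv (x # w))) (word_loop (word_inv w) +++ word_loop [letter_inv x])"
    using x w assms(2) by (simp only: word_inv_simps) (intro word_loop_append; simp)
  also have "?h \<dots> (reversepath (word_loop w) +++ letter_loop (letter_inv x))"
    using x w assms(2)
    using w(2) assms(2) hp_join[OF Cons.IH[OF w(1)] word_loop_single[of "letter_inv x"] path_in_word_loop path_in_word_loop]
    by simp
  finally show ?case by (simp add: reversepath_joinpaths reversepath_letter_loop)
qed

text \<open>An endomorphism of the fundamental group acts on the finite set of homomorphisms to a
  symmetric group by precomposition, injectively if it is onto, hence bijectively; so every element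
  of its kernel is killed by all these homomorphisms, and is trivial by residual finiteness.\<close>
lemma wedge_hopf:
  assumes C_path: "\<And>\<gamma>. path_in (wedge n) 0 0 \<gamma> \<Longrightarrow> path_in (wedge n) 0 0 (C \<gamma>)"
    and C_hom: "\<And>\<gamma> \<delta>. path_in (wedge n) 0 0 \<gamma> \<Longrightarrow> homotopic_paths (wedge n) \<gamma> \<delta> \<Longrightarrow> homotopic_paths (wedge n) (C \<gamma>) (C \<delta>)"
    and C_join: "\<And>\<gamma> \<delta>. path_in (wedge n) 0 0 \<gamma> \<Longrightarrow> path_in (wedge n) 0 0 \<delta> \<Longrightarrow>
      homotopic_paths (wedge n) (C (\<gamma> +++ \<delta>)) (C \<gamma> +++ C \<delta>)"
    and C_const: "homotopic_paths (wedge n) (C (linepath 0 0)) (linepath 0 0)"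
    and C_rev: "\<And>\<gamma>. path_in (wedge n) 0 0 \<gamma> \<Longrightarrow> homotopic_paths (wedge n) (C (reversepath \<gamma>)) (reversepath (C \<gamma>))"
    and C_surj: "\<And>\<gamma>. path_in (wedge n) 0 0 \<gamma> \<Longrightarrow> \<exists>\<delta>. path_in (wedge n) 0 0 \<delta> \<and> homotopic_paths (wedge n) (C \<delta>) \<gamma>"
    and \<delta>: "path_in (wedge n) 0 0 \<delta>" "path_in (wedge n) 0 0 \<delta>'" "homotopic_paths (wedge n) (C \<delta>) (C \<delta>')"
  shows "homotopic_paths (wedge n) \<delta> \<delta>'"
proof -
  let ?h = "homotopic_paths (wedge n)"
  note trans = homotopic_paths_trans and sym = homotopic_paths_sym
  have 0: "0 \<in> wedge n" using path_in_start[OF \<delta>(1)] .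
  have word: "\<exists>w. set w \<subseteq> letters n \<and> ?h \<gamma> (word_loop w)" if "path_in (wedge n) 0 0 \<gamma>" for \<gamma>
    using loop_homotopic_word_loop that unfolding based_loop_iff_path_in by metis
  have pos: "(k, True) \<in> letters n" if "k \<in> {1..n}" for k
    using that by (auto simp: letters_def)
  have "\<exists>w. set w \<subseteq> letters n \<and> ?h (C (letter_loop (k, True))) (word_loop w)" if "k \<in> {1..n}" for k
    by (intro word C_path path_in_letter_loop pos that)
  then obtain c where c: "\<And>k. k \<in> {1..n} \<Longrightarrow> set (c k) \<subseteq> letters n"
    "\<And>k. k \<in> {1..n} \<Longrightarrow> ?h (C (letter_loop (k, True))) (word_loop (c k))" by metis
  \<comment> \<open>On words, \<open>C\<close> is a substitution of words for letters, up to
    homotopy.\<close>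
  define s where "s x = (if snd x then c (fst x) else word_inv (c (fst x)))" for x :: "nat \<times> bool"
  define subst where "subst w = concat (map s w)" for w
  have s: "set (s x) \<subseteq> letters n" if "x \<in> letters n" for x
  proof -
    have "fst x \<in> {1..n}" using that by (auto simp: letters_def)
    then show ?thesis using c(1) by (simp add: s_def)
  qed
  have subst: "set (subst w) \<subseteq> letters n" if "set w \<subseteq> letters n" for w
    using that s by (induction w) (auto simp: subst_def)
  have C_letter: "?h (C (letter_loop x)) (word_loop (s x))" if "x \<in> letters n" for x
  proof -
    obtain k b where x: "x = (k, b)" "k \<in> {1..n}" using \<open>x \<in> letters n\<close> by (cases x) (auto simp: letters_def)
    show ?thesis
    proof (cases b)
      case True
      then show ?thesis using c x by (simp add: s_def)
    next
      case False
      have "?h (C (letter_loop x)) (reversepath (C (letter_loop (k, True))))"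
        using C_rev[OF path_in_letter_loop[OF pos[OF x(2)]]] False x by (simp add: reversepath_letter_loop)
      also have "?h \<dots> (reversepath (word_loop (c k)))"
        using c(2)[OF x(2)] by (simp add: homotopic_paths_reversepath)
      also have "?h \<dots> (word_loop (s x))"
        using sym[OF word_loop_word_inv[OF c(1)[OF x(2)] 0]] False x by (simp add: s_def)
      finally show ?thesis .
    qed
  qed
  have C_word: "?h (C (word_loop w)) (word_loop (subst w))" if "set w \<subseteq> letters n" for w
    using that
  proof (induction w)
    case Nil
    show ?case using C_const unfolding subst_def list.map concat.simps word_loop.simps .
  next
    case (Cons x w)
    then have x: "x \<in> letters n" and w: "set w \<subseteq> letters n" by auto
    note ins = C_path path_in_letter_loop[OF x] path_in_word_loop[OF w 0]
    have "?h (C (word_loop (x # w))) (C (letter_loop x) +++ C (word_loop w))"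
      unfolding word_loop.simps by (intro C_join ins)
    also have "?h \<dots> (word_loop (s x) +++ word_loop (subst w))"
      by (rule hp_join C_letter x Cons.IH w ins)+
    also have "?h \<dots> (word_loop (s x @ subst w))"
      by (intro sym[OF word_loop_append] s x subst w 0)
    finally show ?case by (simp add: subst_def)
  qed
  \<comment> \<open>Precomposition of the homomorphism \<open>\<rho>\<close> with \<open>C\<close>,
    in terms of its values on generators.\<close>
  define \<Phi> where "\<Phi> \<rho> k = (if k \<in> {1..n} then word_act \<rho> (c k) else id)" for \<rho> :: "nat \<Rightarrow> nat \<Rightarrow> nat" and k
  have act_subst: "word_act \<rho> (subst w) = word_act (\<Phi> \<rho>) w" if "\<rho> \<in> perm_tuples n m" "set w \<subseteq> letters n" for \<rho> m w
    using that(2)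
  proof (induction w)
    case (Cons x w)
    have "fst x \<in> {1..n}" using Cons.prems by (auto simp: letters_def)
    then have "word_act \<rho> (s x) = letter_act (\<Phi> \<rho>) x"
      using inv_word_act[of \<rho> "{..m}", OF perm_tuplesD[OF that(1)]] by (auto simp: s_def letter_act_def \<Phi>_def)
    then show ?case using Cons by (simp add: subst_def)
  qed (simp add: subst_def)
  have surj: "\<Phi> ` perm_tuples n m = perm_tuples n m" for m
  proof (rule endo_inj_surj[OF finite_perm_tuples])
    show "\<Phi> ` perm_tuples n m \<subseteq> perm_tuples n m"
    proof clarify
      fix \<rho> assume "\<rho> \<in> perm_tuples n m"
      then have "word_act \<rho> w permutes {..m}" for w
        by (intro word_act_permutes) (rule perm_tuplesD)
      then show "\<Phi> \<rho> \<in> perm_tuples n m" by (auto simp: perm_tuples_def \<Phi>_def)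
    qed
    show "inj_on \<Phi> (perm_tuples n m)"
    proof (rule inj_onI)
      fix \<rho> \<rho>' assume \<rho>: "\<rho> \<in> perm_tuples n m" "\<rho>' \<in> perm_tuples n m" "\<Phi> \<rho> = \<Phi> \<rho>'"
      show "\<rho> = \<rho>'"
      proof
        fix k
        show "\<rho> k = \<rho>' k"
        proof (cases "k \<in> {1..n}")
          case True
          \<comment> \<open>Surjectivity writes generator \<open>k\<close> as the image of a word
            \<open>d\<close>; hence \<open>\<rho> k\<close> is the action of \<open>d\<close> under
            \<open>\<Phi> \<rho>\<close> and is determined by \<open>\<Phi> \<rho>\<close>.\<close>
          obtain \<gamma> where \<gamma>: "path_in (wedge n) 0 0 \<gamma>" "?h (C \<gamma>) (letter_loop (k, True))"
            using C_surj[OF path_in_letter_loop[OF pos[OF True]]] by blast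
          obtain d where d: "set d \<subseteq> letters n" "?h \<gamma> (word_loop d)"
            using word[OF \<gamma>(1)] by blast
          have "?h (word_loop (subst d)) (C (word_loop d))" by (rule sym[OF C_word[OF d(1)]])
          also have "?h \<dots> (C \<gamma>)" by (rule sym[OF C_hom[OF \<gamma>(1) d(2)]])
          also have "?h \<dots> (letter_loop (k, True))" by fact
          also have "?h \<dots> (word_loop [(k, True)])" by (rule sym[OF word_loop_single[OF pos[OF True]]])
          finally have hom: "?h (word_loop (subst d)) (word_loop [(k, True)])" .
          have "set [(k, True)] \<subseteq> letters n" using pos[OF True] by simp
          then have "word_act \<tau> (subst d) = word_act \<tau> [(k, True)]" if "\<tau> \<in> perm_tuples n m" for \<tau>
            using word_act_homotopy_invariant[of \<tau> m "subst d" n, OF perm_tuplesD[OF that] subst[OF d(1)] _ hom] by blast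
          then have "\<tau> k = word_act (\<Phi> \<tau>) d" if "\<tau> \<in> perm_tuples n m" for \<tau>
            using act_subst[OF that d(1)] that by (simp add: letter_act_def)
          then show ?thesis using \<rho> by simp
        next
          case False
          then show ?thesis using \<rho>(1,2) by (simp add: perm_tuples_def)
        qed
      qed
    qed
  qed
  obtain w w' where w: "set w \<subseteq> letters n" "?h \<delta> (word_loop w)" "set w' \<subseteq> letters n" "?h \<delta>' (word_loop w')"
    using word \<delta> by meson
  have "?h (word_loop (subst w)) (C (word_loop w))" by (rule sym[OF C_word[OF w(1)]])
  also have "?h \<dots> (C \<delta>)" by (rule sym[OF C_hom[OF \<delta>(1) w(2)]])
  also have "?h \<dots> (C \<delta>')" by fact
  also have "?h \<dots> (C (word_loop w'))" by (rule C_hom[OF \<delta>(2) w(4)])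
  also have "?h \<dots> (word_loop (subst w'))" by (rule C_word[OF w(3)])
  finally have subst_eq: "?h (word_loop (subst w)) (word_loop (subst w'))" .
  \<comment> \<open>Every \<open>\<rho>\<close> factors through \<open>C\<close> as
    \<open>\<Phi> \<tau>\<close>, so it cannot distinguish two words whose images under
    \<open>C\<close> are homotopic.\<close>
  have triv: "word_act \<rho> (w @ word_inv w') = id" if \<rho>: "\<rho> \<in> perm_tuples n m" for \<rho> m
  proof -
    obtain \<tau> where \<tau>: "\<tau> \<in> perm_tuples n m" "\<rho> = \<Phi> \<tau>" using surj[of m] \<rho> by blast
    have "word_act \<tau> (subst w) = word_act \<tau> (subst w')"
      by (rule word_act_homotopy_invariant[of \<tau> m _ n, OF perm_tuplesD[OF \<tau>(1)] subst subst subst_eq]) (rule w)+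
    then have "word_act \<rho> w = word_act \<rho> w'"
      using act_subst[OF \<tau>(1)] w \<tau>(2) by simp
    moreover have "inv (word_act \<rho> w') \<circ> word_act \<rho> w' = id"
      using permutes_inv_o(2)[OF word_act_permutes[of \<rho> "{..m}", OF perm_tuplesD[OF \<rho>]]] .
    ultimately show ?thesis
      using inv_word_act[of \<rho> "{..m}", OF perm_tuplesD[OF \<rho>]] by simp
  qed
  have "?h (word_loop (w @ word_inv w')) (linepath 0 0)"
  proof (rule residually_finite_word_induct[of _ n])
    show "set (w @ word_inv w') \<subseteq> letters n" using w by simp
    show "?h (word_loop []) (linepath 0 0)" using 0 by simp
    show "?h (word_loop (u @ [x, letter_inv x] @ v)) (linepath 0 0)"
      if "set u \<subseteq> letters n" "set v \<subseteq> letters n" "x \<in> letters n" "?h (word_loop (u @ v)) (linepath 0 0)" for u x v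
      using trans[OF word_loop_cancel[OF that(1-3) 0] that(4)] .
  qed (rule triv)
  moreover have "?h (word_loop w +++ word_loop (word_inv w')) (word_loop (w @ word_inv w'))"
    using w 0 by (intro sym[OF word_loop_append]) auto
  moreover have "?h (word_loop w +++ reversepath (word_loop w')) (word_loop w +++ word_loop (word_inv w'))"
    by (rule hp_join[OF hp_refl sym[OF word_loop_word_inv]] path_in_word_loop path_in_reversepath w(1,3) 0)+
  ultimately have "?h (word_loop w +++ reversepath (word_loop w')) (linepath 0 0)"
    using trans by blast
  then have "homotopic_loops (wedge n) (word_loop w +++ reversepath (word_loop w')) (linepath 0 0)"
    by (rule homotopic_paths_imp_homotopic_loops) auto
  then have "?h (word_loop w) (word_loop w')"
    by (rule homotopic_paths_loop_parts) simp
  then show ?thesis using trans[OF w(2)] trans sym[OF w(4)] by blast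
qed

subsection \<open>Approximating maps between inverse limits\<close>

lemma closed_wedge: "closed (wedge n)" and compact_wedge: "compact (wedge n)"
  unfolding wedge_def by (intro closed_UN compact_UN ballI finite_atLeastAtMost closed_sphere compact_sphere)+

text \<open>Circles are attached one at a time: a union of two closed ENRs is an ENR if their
  intersection is, and here that is a point or empty (for the first circle).\<close>

lemma ENR_wedge: "ENR (wedge n)"
proof (induction n)
  case 0
  then show ?case by (simp add: wedge_def)
next
  case (Suc n)
  let ?C = "sphere (of_nat (Suc n)) (real (Suc n)) :: complex set"
  have eq: "wedge (Suc n) = wedge n \<union> ?C"
    unfolding wedge_def by (simp only: atLeastAtMostSuc_conv UN_insert) auto
  have "wedge n \<inter> ?C \<subseteq> {0}"
  proof
    fix z assume "z \<in> wedge n \<inter> ?C"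
    moreover from this obtain k where "k \<in> {1..n}" "z \<in> sphere (of_nat k) (real k)"
      using wedge_sphereE by blast
    ultimately show "z \<in> {0}"
      using sphere_circle_unique[of z k "Suc n"] by (cases "z = 0") (simp_all del: mem_sphere)
  qed
  then have "ENR (wedge n \<inter> ?C)"
    using subset_singletonD[of "wedge n \<inter> ?C" 0] ENR_empty ENR_singleton[of "0::complex"] by (elim disjE[OF subset_singletonD]) (simp_all only:)
  then show ?case
    unfolding eq by (intro ENR_closed_Un closed_wedge closed_sphere Suc.IH ENR_sphere)
qed

text \<open>The domain is cut down to a closed neighbourhood of the wedge. As a sum of two compact
  sets it is compact, so the retraction is uniformly continuous there, and one
  \<open>\<delta>\<close> works at all points of the wedge.\<close>

lemma wedge_retract:
  "\<exists>N r. continuous_on N r \<and> r ` N \<subseteq> wedge n \<and> (\<forall>w\<in>wedge n. r w = w) \<and>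
    (\<forall>\<eta>>0. \<exists>\<delta>>0. \<forall>w\<in>wedge n. \<forall>z. dist z w < \<delta> \<longrightarrow> z \<in> N \<and> dist (r z) w < \<eta>)"
proof -
  obtain U r where U: "open U" "retraction U (wedge n) r"
    using ENR_wedge[of n] by (auto simp: ENR_def retract_of_def)
  then have r: "wedge n \<subseteq> U" "continuous_on U r" "r ` U \<subseteq> wedge n" "\<And>w. w \<in> wedge n \<Longrightarrow> r w = w"
    unfolding retraction_def by (simp_all only: image_subset_iff_funcset)
  obtain e where e: "e > 0" "(\<Union>w\<in>wedge n. cball w e) \<subseteq> U"
    using compact_subset_open_imp_cball_epsilon_subset[OF compact_wedge U(1) r(1)] .
  define N where "N = {x + y |x y. x \<in> wedge n \<and> y \<in> cball 0 e}"
  have N_in: "z \<in> N" if "w \<in> wedge n" "dist z w \<le> e" for z w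
  proof -
    have "z = w + (z - w) \<and> w \<in> wedge n \<and> z - w \<in> cball 0 e"
      using that by (simp add: dist_norm norm_minus_commute)
    then show ?thesis unfolding N_def by blast
  qed
  have "N \<subseteq> U"
  proof
    fix z assume "z \<in> N"
    then obtain x y where "z = x + y" "x \<in> wedge n" "norm y \<le> e" by (auto simp: N_def)
    then have "z \<in> cball x e" by (simp add: dist_norm)
    then show "z \<in> U" using e(2) \<open>x \<in> wedge n\<close> by blast
  qed
  then have cont: "continuous_on N r" using r(2) continuous_on_subset by blast
  have "compact N" unfolding N_def by (intro compact_sums compact_wedge compact_cball)
  then have unif: "uniformly_continuous_on N r" using cont by (rule compact_uniformly_continuous[rotated])
  show ?thesis
  proof (rule exI[of _ N], rule exI[of _ r], intro conjI ballI allI impI)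
    show "continuous_on N r" by (rule cont)
    show "r ` N \<subseteq> wedge n" using r(3) \<open>N \<subseteq> U\<close> by blast
    show "r w = w" if "w \<in> wedge n" for w using r(4) that .
    fix \<eta> :: real assume "\<eta> > 0"
    then obtain d where d: "d > 0" "\<And>x y. x \<in> N \<Longrightarrow> y \<in> N \<Longrightarrow> dist y x < d \<Longrightarrow> dist (r y) (r x) < \<eta>"
      using unif unfolding uniformly_continuous_on_def by meson
    show "\<exists>\<delta>>0. \<forall>w\<in>wedge n. \<forall>z. dist z w < \<delta> \<longrightarrow> z \<in> N \<and> dist (r z) w < \<eta>"
    proof (intro exI conjI ballI allI impI)
      show "min d e > 0" using d e by simp
      fix w z assume w: "w \<in> wedge n" and z: "dist z w < min d e"
      show zN: "z \<in> N" using N_in[OF w] z by simp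
      show "dist (r z) w < \<eta>" using d(2)[OF N_in[OF w, of w] zN] r(4)[OF w] z e(1) w by simp
    qed
  qed
qed

definition wedge_map :: "nat \<Rightarrow> (complex \<Rightarrow> complex) \<Rightarrow> bool" where
  "wedge_map n f \<longleftrightarrow> continuous_on (wedge n) f \<and> f ` wedge n \<subseteq> wedge n"

lemma wedge_mapD: "wedge_map n f \<Longrightarrow> continuous_on (wedge n) f" "wedge_map n f \<Longrightarrow> z \<in> wedge n \<Longrightarrow> f z \<in> wedge n"
  by (auto simp: wedge_map_def)

text \<open>The straight-line homotopy stays in the neighbourhood and is then retracted. The bound
  depends only on \<open>n\<close>, so it can be fixed before any approximation is chosen; 0 may
  move during the homotopy.\<close>

lemma near_maps_homotopic:
  "\<exists>\<epsilon>>0. \<forall>F G. wedge_map n F \<and> wedge_map n G \<and> (\<forall>z\<in>wedge n. dist (F z) (G z) < \<epsilon>) \<longrightarrow>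
     (\<exists>h. continuous_on ({0..1::real} \<times> wedge n) h \<and> h ` ({0..1} \<times> wedge n) \<subseteq> wedge n \<and>
        (\<forall>z\<in>wedge n. h (0, z) = F z \<and> h (1, z) = G z))"
proof -
  obtain N r where r: "continuous_on N r" "r ` N \<subseteq> wedge n" "\<forall>w\<in>wedge n. r w = w"
    and r_near: "\<forall>\<eta>>0. \<exists>\<delta>>0. \<forall>w\<in>wedge n. \<forall>z. dist z w < \<delta> \<longrightarrow> z \<in> N \<and> dist (r z) w < \<eta>"
    using wedge_retract[of n] by (elim exE conjE)
  \<comment> \<open>Any positive number could stand for 1: what matters is that points within
    \<open>\<epsilon>\<close> of the wedge lie in \<open>N\<close>.\<close>
  obtain \<epsilon> where \<epsilon>: "\<epsilon> > 0" "\<forall>w\<in>wedge n. \<forall>z. dist z w < \<epsilon> \<longrightarrow> z \<in> N \<and> dist (r z) w < 1"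
    using r_near[rule_format, OF zero_less_one] by (elim exE conjE)
  show ?thesis
  proof (rule exI[of _ \<epsilon>], intro conjI allI impI)
    show "\<epsilon> > 0" by (rule \<epsilon>(1))
    fix F G assume FG: "wedge_map n F \<and> wedge_map n G \<and> (\<forall>z\<in>wedge n. dist (F z) (G z) < \<epsilon>)"
    then have F: "continuous_on (wedge n) F" "F ` wedge n \<subseteq> wedge n"
      and G: "continuous_on (wedge n) G" "G ` wedge n \<subseteq> wedge n"
      and near: "\<And>z. z \<in> wedge n \<Longrightarrow> dist (F z) (G z) < \<epsilon>"
      unfolding wedge_map_def by blast+
    define k where "k = (\<lambda>(t::real, z). (1 - t) *\<^sub>R F z + t *\<^sub>R G z)"
    have kN: "k (t, z) \<in> N" if t: "t \<in> {0..1}" and z: "z \<in> wedge n" for t z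
    proof -
      have "F z - k (t, z) = t *\<^sub>R (F z - G z)"
        by (simp add: k_def algebra_simps)
      then have "dist (k (t, z)) (F z) = t * dist (F z) (G z)"
        using t by (simp add: dist_norm norm_minus_commute)
      also have "\<dots> \<le> dist (F z) (G z)"
        using t by (simp add: mult_left_le_one_le)
      also have "\<dots> < \<epsilon>" using near z .
      finally show ?thesis using \<epsilon>(2) F(2) z by (metis image_subset_iff)
    qed
    have "continuous_on ({0..1} \<times> wedge n) k"
      unfolding k_def case_prod_unfold
      by (intro continuous_intros continuous_on_compose2[OF F(1)] continuous_on_compose2[OF G(1)]) auto
    then have "continuous_on ({0..1} \<times> wedge n) (r \<circ> k)"
      using kN by (intro continuous_on_compose continuous_on_subset[OF r(1)]) auto
    moreover have "(r \<circ> k) ` ({0..1} \<times> wedge n) \<subseteq> wedge n"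
      using kN r(2) by (auto simp: image_subset_iff)
    moreover have "\<forall>z\<in>wedge n. (r \<circ> k) (0, z) = F z \<and> (r \<circ> k) (1, z) = G z"
      using r(3) F(2) G(2) by (auto simp: k_def)
    ultimately show "\<exists>h. continuous_on ({0..1::real} \<times> wedge n) h \<and> h ` ({0..1} \<times> wedge n) \<subseteq> wedge n \<and>
         (\<forall>z\<in>wedge n. h (0, z) = F z \<and> h (1, z) = G z)"
      by blast
  qed
qed

lemma wedge_map_compose:
  assumes f: "wedge_map n f" and g: "wedge_map n g"
  shows "wedge_map n (f \<circ> g)"
proof -
  have "g ` wedge n \<subseteq> wedge n" using g by (simp add: wedge_map_def)
  then have "continuous_on (g ` wedge n) f" "f ` (g ` wedge n) \<subseteq> wedge n"
    using f continuous_on_subset[of "wedge n" f] by (auto simp: wedge_map_def)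
  then show ?thesis
    using g continuous_on_compose[of "wedge n" g f] by (simp add: wedge_map_def image_comp)
qed

section \<open>Inverse limits and functions of one coordinate\<close>

definition inv_limit :: "nat \<Rightarrow> (nat \<Rightarrow> complex \<Rightarrow> complex) \<Rightarrow> (nat \<Rightarrow> complex) set" where
  "inv_limit n f = {y. \<forall>i. y i \<in> wedge n \<and> y i = f i (y (Suc i))}"

lemma inv_limitD: "y \<in> inv_limit n f \<Longrightarrow> \<forall>i. y i \<in> wedge n \<and> y i = f i (y (Suc i))"
  unfolding inv_limit_def mem_Collect_eq .

lemma inv_limit_in_wedge: "y \<in> inv_limit n f \<Longrightarrow> y i \<in> wedge n"
  by (rule conjunct1[OF spec[OF inv_limitD]])

lemma inv_limit_bond: "y \<in> inv_limit n f \<Longrightarrow> f i (y (Suc i)) = y i"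
  by (rule sym[OF conjunct2[OF spec[OF inv_limitD]]])

text \<open>The bonding map from level \<open>m + d\<close> to level \<open>m\<close>. New factors
  are added on the inside, so a map composed with a longer tower is its composition with the shorter
  one followed on the right by the next bonding map.\<close>

fun tower :: "(nat \<Rightarrow> 'a \<Rightarrow> 'a) \<Rightarrow> nat \<Rightarrow> nat \<Rightarrow> 'a \<Rightarrow> 'a" where
  "tower f m 0 = id"
| "tower f m (Suc d) = tower f m d \<circ> f (m + d)"

lemma tower_apply: "y \<in> inv_limit n f \<Longrightarrow> tower f m d (y (m + d)) = y m"
  by (induction d) (simp_all add: inv_limit_bond)

lemma wedge_map_tower: "(\<And>i. wedge_map n (f i)) \<Longrightarrow> wedge_map n (tower f m d)"
proof (induction d)
  case 0
  then show ?case by (simp add: wedge_map_def)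
next
  case (Suc d)
  show ?case
    unfolding tower.simps by (rule wedge_map_compose[OF Suc.IH[OF Suc.prems] Suc.prems])
qed

text \<open>Functions of a single coordinate form an algebra: two coordinates are both functions of
  any later one, so sums and products can be formed at a common level. They separate points, and
  Stone-Weierstrass applies.\<close>

lemma inv_limit_real_approx:
  assumes f: "\<And>i. wedge_map n (f i)" and cpt: "compact (inv_limit n f)"
    and F: "continuous_on (inv_limit n f) F" and e: "e > (0::real)"
  shows "\<exists>m u. continuous_on (wedge n) u \<and> (\<forall>y\<in>inv_limit n f. \<bar>F y - u (y m)\<bar> < e)"
proof -
  let ?L = "inv_limit n f"
  define R where "R = {h :: (nat \<Rightarrow> complex) \<Rightarrow> real. \<exists>m u. continuous_on (wedge n) u \<and> (\<forall>y\<in>?L. h y = u (y m))}"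
  have raise: "\<exists>u. continuous_on (wedge n) u \<and> (\<forall>y\<in>?L. h y = u (y m'))"
    if "continuous_on (wedge n) u" "\<forall>y\<in>?L. h y = u (y m)" "m \<le> m'" for h :: "(nat \<Rightarrow> complex) \<Rightarrow> real" and u m m'
  proof (intro exI conjI ballI)
    have t: "wedge_map n (tower f m (m' - m))" by (rule wedge_map_tower[of n f, OF f])
    show "continuous_on (wedge n) (u \<circ> tower f m (m' - m))"
      using t that(1) by (intro continuous_on_compose) (auto simp: wedge_map_def intro: continuous_on_subset)
    show "h y = (u \<circ> tower f m (m' - m)) (y m')" if "y \<in> ?L" for y
      using tower_apply[OF that, of m "m' - m"] \<open>\<forall>y\<in>?L. h y = u (y m)\<close> that \<open>m \<le> m'\<close> by simp
  qed
  have RI: "h \<in> R" if "continuous_on (wedge n) u" "\<forall>y\<in>?L. h y = u (y m)" for h u m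
    unfolding R_def using that by (intro CollectI exI[of _ m] exI[of _ u] conjI)
  have common: "\<exists>m u v. continuous_on (wedge n) u \<and> continuous_on (wedge n) v \<and>
      (\<forall>y\<in>?L. h y = u (y m)) \<and> (\<forall>y\<in>?L. k y = v (y m))" if hk: "h \<in> R" "k \<in> R" for h k
  proof -
    obtain m u m' u' where *: "continuous_on (wedge n) u" "\<forall>y\<in>?L. h y = u (y m)"
      "continuous_on (wedge n) u'" "\<forall>y\<in>?L. k y = u' (y m')"
      using hk unfolding R_def by blast
    show ?thesis
      using raise[OF *(1,2), of "max m m'"] raise[OF *(3,4), of "max m m'"] by (metis max.cobounded1 max.cobounded2)
  qed
  have coord: "continuous_on ?L (\<lambda>y. y m)" for m
    by (rule continuous_on_subset[OF continuous_on_product_coordinates subset_UNIV])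
  interpret function_ring_on R ?L
  proof
    show "compact ?L" by fact
    show "continuous_on ?L h" if h: "h \<in> R" for h
    proof -
      obtain m u where u: "continuous_on (wedge n) u" "\<forall>y\<in>?L. h y = u (y m)"
        using h unfolding R_def by blast
      have "continuous_on ?L (\<lambda>y. u (y m))"
        by (rule continuous_on_compose2[OF u(1) coord]) (auto simp: inv_limit_in_wedge)
      then show ?thesis using u(2) by (metis (no_types, lifting) continuous_on_cong)
    qed
    show "(\<lambda>y. h y + k y) \<in> R" if hk: "h \<in> R" "k \<in> R" for h k
    proof -
      obtain m u v where uv: "continuous_on (wedge n) u" "continuous_on (wedge n) v"
        "\<forall>y\<in>?L. h y = u (y m)" "\<forall>y\<in>?L. k y = v (y m)" using common[OF hk] by blast
      show ?thesis
      proof (rule RI[where m = m])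
        show "continuous_on (wedge n) (\<lambda>z. u z + v z)" by (rule continuous_on_add[OF uv(1,2)])
        show "\<forall>y\<in>?L. h y + k y = u (y m) + v (y m)" by (rule ballI) (simp only: bspec[OF uv(3)] bspec[OF uv(4)])
      qed
    qed
    show "(\<lambda>y. h y * k y) \<in> R" if hk: "h \<in> R" "k \<in> R" for h k
    proof -
      obtain m u v where uv: "continuous_on (wedge n) u" "continuous_on (wedge n) v"
        "\<forall>y\<in>?L. h y = u (y m)" "\<forall>y\<in>?L. k y = v (y m)" using common[OF hk] by blast
      show ?thesis
      proof (rule RI[where m = m])
        show "continuous_on (wedge n) (\<lambda>z. u z * v z)" by (rule continuous_on_mult[OF uv(1,2)])
        show "\<forall>y\<in>?L. h y * k y = u (y m) * v (y m)" by (rule ballI) (simp only: bspec[OF uv(3)] bspec[OF uv(4)])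
      qed
    qed
    show "(\<lambda>_. c) \<in> R" for c
      by (rule RI[where m = 0 and u = "\<lambda>_. c"]) simp_all
    fix x y assume "x \<in> ?L" "y \<in> ?L" "x \<noteq> y"
    then obtain i where i: "x i \<noteq> y i" by (auto simp only: fun_eq_iff)
    have Re: "(\<lambda>y. Re (y i)) \<in> R"
      by (rule RI[where m = i and u = Re]) (simp_all add: continuous_on_Re)
    have Im: "(\<lambda>y. Im (y i)) \<in> R"
      by (rule RI[where m = i and u = Im]) (simp_all add: continuous_on_Im)
    show "\<exists>h\<in>R. h x \<noteq> h y"
    proof (cases "Re (x i) = Re (y i)")
      case True
      then have "Im (x i) \<noteq> Im (y i)" using i by (simp add: complex_eq_iff)
      then show ?thesis by (rule bexI[OF _ Im])
    qed (rule bexI[OF _ Re])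
  qed
  obtain g where g: "g \<in> R" "\<forall>y\<in>?L. \<bar>F y - g y\<bar> < e"
    using Stone_Weierstrass_basic[OF F e] by blast
  obtain m u where u: "continuous_on (wedge n) u" "\<forall>y\<in>?L. g y = u (y m)"
    using g(1) unfolding R_def by blast
  have near: "\<bar>F y - u (y m)\<bar> < e" if "y \<in> ?L" for y
    using bspec[OF g(2) that] by (simp only: bspec[OF u(2) that])
  show ?thesis
    by (rule exI[of _ m], rule exI[of _ u], rule conjI[OF u(1)], rule ballI, rule near)
qed

text \<open>Real and imaginary parts are approximated separately, which gives values near the wedge
  but not in it; the retraction corrects this at the price of \<open>\<eta>\<close>.\<close>

lemma inv_limit_approx:
  assumes f: "\<And>i. wedge_map n (f i)" and cpt: "compact (inv_limit n f)"
    and onto: "\<And>m. (\<lambda>y. y m) ` inv_limit n f = wedge n"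
    and F: "continuous_on (inv_limit n f) F" "F ` inv_limit n f \<subseteq> wedge n" and \<eta>: "\<eta> > (0::real)"
  shows "\<exists>a m. wedge_map n a \<and> (\<forall>y\<in>inv_limit n f. dist (a (y m)) (F y) < \<eta>)"
proof -
  let ?L = "inv_limit n f"
  obtain N r where r: "continuous_on N r" "r ` N \<subseteq> wedge n" "\<forall>w\<in>wedge n. r w = w"
    and r_near: "\<forall>\<eta>>0. \<exists>\<delta>>0. \<forall>w\<in>wedge n. \<forall>z. dist z w < \<delta> \<longrightarrow> z \<in> N \<and> dist (r z) w < \<eta>"
    using wedge_retract[of n] by (elim exE conjE)
  obtain \<delta> where \<delta>: "\<delta> > 0" "\<forall>w\<in>wedge n. \<forall>z. dist z w < \<delta> \<longrightarrow> z \<in> N \<and> dist (r z) w < \<eta>"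
    using r_near[rule_format, OF \<eta>] by (elim exE conjE)
  obtain m1 u1 where 1: "continuous_on (wedge n) u1" "\<forall>y\<in>?L. \<bar>Re (F y) - u1 (y m1)\<bar> < \<delta> / 2"
    using inv_limit_real_approx[OF f cpt, of "\<lambda>y. Re (F y)" "\<delta> / 2"] continuous_on_Re[OF F(1)] \<delta>(1) by auto
  obtain m2 u2 where 2: "continuous_on (wedge n) u2" "\<forall>y\<in>?L. \<bar>Im (F y) - u2 (y m2)\<bar> < \<delta> / 2"
    using inv_limit_real_approx[OF f cpt, of "\<lambda>y. Im (F y)" "\<delta> / 2"] continuous_on_Im[OF F(1)] \<delta>(1) by auto
  \<comment> \<open>A level above both \<open>m1\<close> and \<open>m2\<close>; the towers of
    lengths \<open>m2\<close> and \<open>m1\<close> lead down to them.\<close>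
  define m where "m = m1 + m2"
  define a where "a z = Complex (u1 (tower f m1 m2 z)) (u2 (tower f m2 m1 z))" for z
  have t: "wedge_map n (tower f i d)" for i d
    by (rule wedge_map_tower[of n f, OF f])
  have "continuous_on (wedge n) a"
    unfolding a_def Complex_eq using wedge_mapD[OF t]
    by (intro continuous_intros continuous_on_compose2[OF 1(1)] continuous_on_compose2[OF 2(1)]) auto
  have near: "dist (a (y m)) (F y) < \<delta>" if y: "y \<in> ?L" for y
  proof -
    have "tower f m1 m2 (y m) = y m1" "tower f m2 m1 (y m) = y m2"
      using tower_apply[OF y, of m1 m2] tower_apply[OF y, of m2 m1] by (simp_all add: m_def add.commute)
    then have "\<bar>Re (a (y m) - F y)\<bar> < \<delta> / 2" "\<bar>Im (a (y m) - F y)\<bar> < \<delta> / 2"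
      using 1(2) 2(2) y by (auto simp: a_def abs_minus_commute)
    then show ?thesis
      using cmod_le[of "a (y m) - F y"] by (simp add: dist_norm)
  qed
  \<comment> \<open>The estimate is known only on coordinates of points of the limit; since the
    projection is onto, these are all points of the wedge.\<close>
  have N: "a z \<in> N" if z: "z \<in> wedge n" for z
  proof -
    have "z \<in> (\<lambda>y. y m) ` ?L" unfolding onto by (rule z)
    then obtain y where y: "y \<in> ?L" "z = y m" by blast
    then have "F y \<in> wedge n" using F(2) by blast
    then show ?thesis using near[OF y(1)] \<delta>(2) unfolding y(2) by blast
  qed
  show ?thesis
  proof (rule exI[of _ "r \<circ> a"], rule exI[of _ m], intro conjI ballI)
    show "wedge_map n (r \<circ> a)"
    proof -
      have "a ` wedge n \<subseteq> N" using N by blast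
      then have "continuous_on (a ` wedge n) r" "r ` (a ` wedge n) \<subseteq> wedge n"
        using r(2) continuous_on_subset[OF r(1)] by blast+
      then show ?thesis
        using continuous_on_compose[OF \<open>continuous_on (wedge n) a\<close>] by (simp add: wedge_map_def image_comp)
    qed
    show "dist ((r \<circ> a) (y m)) (F y) < \<eta>" if y: "y \<in> ?L" for y
    proof -
      have "F y \<in> wedge n" using F(2) y by blast
      then show ?thesis using near[OF y] \<delta>(2) by simp
    qed
  qed
qed

subsection \<open>Surjectivity on the fundamental group\<close>

lemma continuous_square_homotopic:
  fixes H :: "real \<times> real \<Rightarrow> 'a::real_normed_vector"
  assumes H: "continuous_on ({0..1} \<times> {0..1}) H" "H ` ({0..1} \<times> {0..1}) \<subseteq> S"
  shows "homotopic_paths S ((\<lambda>s. H (0, s)) +++ (\<lambda>t. H (t, 1))) ((\<lambda>t. H (t, 0)) +++ (\<lambda>s. H (1, s)))"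
proof -
  let ?Q = "{0..1} \<times> {0..1} :: (real \<times> real) set"
  let ?p = "linepath (0, 0) (0, 1) +++ linepath (0, 1) (1, 1) :: real \<Rightarrow> real \<times> real"
  let ?q = "linepath (0, 0) (1, 0) +++ linepath (1, 0) (1, 1) :: real \<Rightarrow> real \<times> real"
  have conv: "convex ?Q" by (intro convex_Times) auto
  have im: "path_image ?p \<subseteq> ?Q" "path_image ?q \<subseteq> ?Q"
    using closed_segment_subset[OF _ _ conv, of "(0, 0)" "(0, 1)"] closed_segment_subset[OF _ _ conv, of "(0, 1)" "(1, 1)"]
      closed_segment_subset[OF _ _ conv, of "(0, 0)" "(1, 0)"] closed_segment_subset[OF _ _ conv, of "(1, 0)" "(1, 1)"]
    by (simp_all add: path_image_join)
  have "homotopic_paths ?Q ?p ?q"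
  proof (rule homotopic_paths_linear)
    fix t :: real assume "t \<in> {0..1}"
    then have "?p t \<in> ?Q" "?q t \<in> ?Q" using im by (auto simp only: path_image_def)
    then show "closed_segment (?p t) (?q t) \<subseteq> ?Q" using conv by (simp only: closed_segment_subset)
  qed (auto intro: path_join_imp)
  then have "homotopic_paths S (H \<circ> ?p) (H \<circ> ?q)"
    using H by (intro homotopic_paths_continuous_image) auto
  moreover have "H \<circ> linepath (0, 0) (0, 1) = (\<lambda>s. H (0, s))" "H \<circ> linepath (0, 1) (1, 1) = (\<lambda>t. H (t, 1))"
    "H \<circ> linepath (0, 0) (1, 0) = (\<lambda>t. H (t, 0))" "H \<circ> linepath (1, 0) (1, 1) = (\<lambda>s. H (1, s))"
    by (auto simp: linepath_def)
  ultimately show ?thesis by (simp only: path_compose_join)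
qed

text \<open>A free homotopy changes the induced map on loops by conjugation with the track of the
  base point.\<close>

lemma homotopic_maps_conjugate:
  fixes h :: "real \<times> 'a::real_normed_vector \<Rightarrow> 'b::real_normed_vector"
  assumes h: "continuous_on ({0..1} \<times> S) h" "h ` ({0..1} \<times> S) \<subseteq> T"
    and F: "\<And>z. z \<in> S \<Longrightarrow> h (0, z) = F z" "\<And>z. z \<in> S \<Longrightarrow> h (1, z) = G z"
    and \<gamma>: "path_in S x x \<gamma>"
  shows "path_in T (F x) (G x) (\<lambda>t. h (t, x))"
    and "homotopic_paths T (F \<circ> \<gamma>) (conj_path (\<lambda>t. h (t, x)) (G \<circ> \<gamma>))"
proof -
  let ?h = "homotopic_paths T" and ?e = "\<lambda>t. h (t, x)"
  have x: "x \<in> S" using path_in_start[OF \<gamma>] .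
  have \<gamma>S: "\<gamma> t \<in> S" if "t \<in> {0..1}" for t
    using \<gamma> that by (auto simp: path_in_def path_image_def)
  have \<gamma>01: "\<gamma> 0 = x" "\<gamma> 1 = x" and c\<gamma>: "continuous_on {0..1} \<gamma>"
    using \<gamma> by (auto simp: path_in_def path_def pathstart_def pathfinish_def)
  have "continuous_on {0..1} ?e"
    using x by (intro continuous_on_compose2[OF h(1)] continuous_intros) auto
  then show e: "path_in T (F x) (G x) ?e"
    using h(2) x F by (auto simp: path_in_def path_def path_image_def pathstart_def pathfinish_def image_subset_iff)
  \<comment> \<open>Two opposite sides of this square are the images of \<open>\<gamma>\<close>; the
    other two both equal the track, because \<open>\<gamma>\<close> is a loop.\<close>
  define H where "H = (\<lambda>(t, s). h (t, \<gamma> s))"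
  have H: "continuous_on ({0..1} \<times> {0..1}) H" "H ` ({0..1} \<times> {0..1}) \<subseteq> T"
    unfolding H_def case_prod_unfold using \<gamma>S h(2)
    by (auto intro!: continuous_intros continuous_on_compose2[OF h(1)] continuous_on_compose2[OF c\<gamma>])
  have FG: "path_in T (F x) (F x) (F \<circ> \<gamma>)" "path_in T (G x) (G x) (G \<circ> \<gamma>)"
  proof -
    have "continuous_on S (\<lambda>z. h (t, z))" "(\<lambda>z. h (t, z)) ` S \<subseteq> T" if "t \<in> {0..1}" for t
      using that h(2) by (auto simp: image_subset_iff intro!: continuous_on_compose2[OF h(1)] continuous_on_Pair)
    from this[of 0] this[of 1]
    have cF: "continuous_on S F" "F ` S \<subseteq> T" and cG: "continuous_on S G" "G ` S \<subseteq> T"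
      using F by (auto elim!: continuous_on_eq simp: image_subset_iff)
    show "path_in T (F x) (F x) (F \<circ> \<gamma>)" by (rule path_in_compose[OF \<gamma> cF])
    show "path_in T (G x) (G x) (G \<circ> \<gamma>)" by (rule path_in_compose[OF \<gamma> cG])
  qed
  \<comment> \<open>These are homotopies and not equations of functions, since the two sides are
    known to agree only for parameters in [0, 1].\<close>
  have eqF: "?h (F \<circ> \<gamma>) (\<lambda>s. H (0, s))" and eqG: "?h (G \<circ> \<gamma>) (\<lambda>s. H (1, s))"
    using FG \<gamma>S F by (auto intro!: homotopic_paths_eq simp: path_in_def H_def)
  have eta: "(\<lambda>t. H (t, 1)) = ?e" "(\<lambda>t. H (t, 0)) = ?e"
    by (auto simp: H_def \<gamma>01)
  have sq: "?h ((\<lambda>s. H (0, s)) +++ ?e) (?e +++ (\<lambda>s. H (1, s)))"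
    using continuous_square_homotopic[OF H] unfolding eta .
  have er: "path_in T (G x) (F x) (reversepath ?e)" by (rule path_in_reversepath[OF e])
  have inv: "?h (?e +++ reversepath ?e) (linepath (F x) (F x))"
    using homotopic_paths_rinv[of ?e T] e by (simp add: path_in_def)
  have rid: "?h (F \<circ> \<gamma>) ((F \<circ> \<gamma>) +++ linepath (F x) (F x))"
    using FG(1) by (intro homotopic_paths_sym[OF homotopic_paths_rid']) (simp_all add: path_in_def)
  note rid
  also have "?h \<dots> ((F \<circ> \<gamma>) +++ (?e +++ reversepath ?e))"
    by (rule hp_join[OF hp_refl homotopic_paths_sym[OF inv]] FG path_in_const path_in_start[OF FG(1)])+
  also have "?h \<dots> (((F \<circ> \<gamma>) +++ ?e) +++ reversepath ?e)"
    by (rule hp_assoc FG e er)+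
  also have "?h \<dots> ((?e +++ (G \<circ> \<gamma>)) +++ reversepath ?e)"
  proof -
    have "?h ((F \<circ> \<gamma>) +++ ?e) ((\<lambda>s. H (0, s)) +++ ?e)" by (rule hp_join[OF eqF hp_refl] FG e)+
    also have "?h \<dots> (?e +++ (\<lambda>s. H (1, s)))" by (rule sq)
    also have "?h \<dots> (?e +++ (G \<circ> \<gamma>))"
      by (rule hp_join[OF hp_refl homotopic_paths_sym[OF eqG]] path_in_homotopic[OF eqG] FG e)+
    finally have "?h ((F \<circ> \<gamma>) +++ ?e) (?e +++ (G \<circ> \<gamma>))" .
    then show ?thesis by (rule hp_join[OF _ hp_refl]) (rule path_in_join FG e er)+
  qed
  also have "?h \<dots> (?e +++ ((G \<circ> \<gamma>) +++ reversepath ?e))"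
    by (rule homotopic_paths_sym[OF hp_assoc] FG e er)+
  finally show "?h (F \<circ> \<gamma>) (conj_path ?e (G \<circ> \<gamma>))" unfolding conj_path_def .
qed

text \<open>The path l leads from 0 to \<open>c 0\<close>, since maps obtained by approximation need not fix 0.\<close>
definition pi1_onto :: "nat \<Rightarrow> (real \<Rightarrow> complex) \<Rightarrow> (complex \<Rightarrow> complex) \<Rightarrow> bool" where
  "pi1_onto n l c \<longleftrightarrow> (\<forall>\<gamma>. path_in (wedge n) 0 0 \<gamma> \<longrightarrow>
     (\<exists>\<delta>. path_in (wedge n) 0 0 \<delta> \<and> homotopic_paths (wedge n) (conj_path l (c \<circ> \<delta>)) \<gamma>))"

lemma path_in_wedge_map: "wedge_map n c \<Longrightarrow> path_in (wedge n) a b p \<Longrightarrow> path_in (wedge n) (c a) (c b) (c \<circ> p)"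
  by (simp add: path_in_compose wedge_map_def)

lemma wedge_map_homotopic:
  "wedge_map n c \<Longrightarrow> homotopic_paths (wedge n) p q \<Longrightarrow> homotopic_paths (wedge n) (c \<circ> p) (c \<circ> q)"
  by (rule homotopic_paths_continuous_image) (auto simp: wedge_map_def)

text \<open>Conjugation with \<open>l\<close> turns \<open>c\<close> into an operation on loops at 0
  that respects homotopy, joins and reversals, which is the form of endomorphism that
  \<open>wedge_hopf\<close> accepts.\<close>

lemma pi1_onto_imp_injective:
  assumes c: "wedge_map n c" and l: "path_in (wedge n) 0 (c 0) l" and onto: "pi1_onto n l c"
    and \<delta>: "path_in (wedge n) 0 0 \<delta>" "path_in (wedge n) 0 0 \<delta>'"
      "homotopic_paths (wedge n) (conj_path l (c \<circ> \<delta>)) (conj_path l (c \<circ> \<delta>'))"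
  shows "homotopic_paths (wedge n) \<delta> \<delta>'"
proof (rule wedge_hopf[of n "\<lambda>\<gamma>. conj_path l (c \<circ> \<gamma>)"])
  let ?h = "homotopic_paths (wedge n)"
  note pin = path_in_wedge_map[OF c, of 0 0]
  have 0: "0 \<in> wedge n" using path_in_start[OF \<delta>(1)] .
  show "path_in (wedge n) 0 0 (conj_path l (c \<circ> \<gamma>))" if "path_in (wedge n) 0 0 \<gamma>" for \<gamma>
    by (rule path_in_conj[OF l pin[OF that]])
  show "?h (conj_path l (c \<circ> \<gamma>)) (conj_path l (c \<circ> \<gamma>'))" if "path_in (wedge n) 0 0 \<gamma>" "?h \<gamma> \<gamma>'" for \<gamma> \<gamma>'
    by (rule conj_path_cong[OF wedge_map_homotopic[OF c that(2)] l pin[OF that(1)]])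
  show "?h (conj_path l (c \<circ> (\<gamma> +++ \<gamma>'))) (conj_path l (c \<circ> \<gamma>) +++ conj_path l (c \<circ> \<gamma>'))"
    if "path_in (wedge n) 0 0 \<gamma>" "path_in (wedge n) 0 0 \<gamma>'" for \<gamma> \<gamma>'
    unfolding path_compose_join by (rule conj_path_join[OF l pin[OF that(1)] pin[OF that(2)]])
  have "c \<circ> linepath 0 0 = linepath (c 0) (c 0)" by (auto simp: linepath_def fun_eq_iff scaleR_left_diff_distrib)
  then show "?h (conj_path l (c \<circ> linepath 0 0)) (linepath 0 0)"
    using conj_path_const[OF l] by simp
  show "?h (conj_path l (c \<circ> reversepath \<gamma>)) (reversepath (conj_path l (c \<circ> \<gamma>)))" if "path_in (wedge n) 0 0 \<gamma>" for \<gamma>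
    unfolding path_compose_reversepath by (rule homotopic_paths_sym[OF reversepath_conj_path[OF l pin[OF that]]])
  show "\<exists>\<delta>. path_in (wedge n) 0 0 \<delta> \<and> ?h (conj_path l (c \<circ> \<delta>)) \<gamma>" if "path_in (wedge n) 0 0 \<gamma>" for \<gamma>
    using onto that unfolding pi1_onto_def by blast
qed (rule \<delta>)+

lemma wedge_path_from_0:
  assumes "z \<in> wedge n" obtains l where "path_in (wedge n) 0 z l"
proof -
  obtain k a where "k \<in> {1..n}" "z = circ k a" using assms by (rule wedge_circE)
  then show ?thesis using that[of "seg k 0 a"] path_image_seg by (auto simp: path_in_def)
qed

text \<open>Up to conjugation by a loop at 0, the action of \<open>c\<close> after that of
  \<open>a\<close> equals the action of \<open>t\<close>. Conjugation by a loop is invertible, so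
  surjectivity of \<open>t\<close> passes to the outer factor \<open>c\<close>.\<close>

lemma pi1_onto_of_homotopic_factor:
  assumes c: "wedge_map n c" and a: "wedge_map n a" and t: "t 0 = 0"
    and h: "continuous_on ({0..1} \<times> wedge n) h" "h ` ({0..1::real} \<times> wedge n) \<subseteq> wedge n"
      "\<forall>z\<in>wedge n. h (0, z) = (c \<circ> a) z \<and> h (1, z) = t z"
    and onto: "\<And>\<gamma>. path_in (wedge n) 0 0 \<gamma> \<Longrightarrow> \<exists>\<delta>. path_in (wedge n) 0 0 \<delta> \<and> homotopic_paths (wedge n) (t \<circ> \<delta>) \<gamma>"
    and l: "path_in (wedge n) 0 (c 0) l"
  shows "pi1_onto n l c"
  unfolding pi1_onto_def
proof (intro allI impI)
  fix \<gamma> assume \<gamma>: "path_in (wedge n) 0 0 \<gamma>"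
  let ?h = "homotopic_paths (wedge n)"
  have 0: "0 \<in> wedge n" using path_in_start[OF \<gamma>] .
  obtain \<mu> where \<mu>: "path_in (wedge n) 0 (a 0) \<mu>"
    using wedge_path_from_0[OF wedge_mapD(2)[OF a 0]] .
  have track: "path_in (wedge n) (c (a 0)) 0 (\<lambda>s. h (s, 0))"
    and conj: "path_in (wedge n) 0 0 \<delta> \<Longrightarrow> ?h (c \<circ> (a \<circ> \<delta>)) (conj_path (\<lambda>s. h (s, 0)) (t \<circ> \<delta>))" for \<delta>
    using homotopic_maps_conjugate[OF h(1,2), of "c \<circ> a" t 0] h(3) \<gamma> t by (simp_all add: o_assoc)
  define \<eta> where "\<eta> = (\<lambda>s. h (s, 0))"
  \<comment> \<open>All base point corrections in a row: from 0 to \<open>c 0\<close>, on to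
    \<open>c (a 0)\<close>, and along the homotopy back to \<open>t 0 = 0\<close>.\<close>
  define \<nu> where "\<nu> = l +++ ((c \<circ> \<mu>) +++ \<eta>)"
  have c\<mu>: "path_in (wedge n) (c 0) (c (a 0)) (c \<circ> \<mu>)" by (rule path_in_wedge_map[OF c \<mu>])
  have \<eta>: "path_in (wedge n) (c (a 0)) 0 \<eta>" using track by (simp only: \<eta>_def)
  have \<nu>: "path_in (wedge n) 0 0 \<nu>" unfolding \<nu>_def by (rule path_in_join l c\<mu> \<eta>)+
  \<comment> \<open>The target is conjugated backwards in advance, so that the later conjugation by
    \<open>\<nu>\<close> restores \<open>\<gamma>\<close>.\<close>
  obtain \<delta> where \<delta>: "path_in (wedge n) 0 0 \<delta>" "?h (t \<circ> \<delta>) (conj_path (reversepath \<nu>) \<gamma>)"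
    using onto[OF path_in_conj[OF path_in_reversepath[OF \<nu>] \<gamma>]] by blast
  have a\<delta>: "path_in (wedge n) (a 0) (a 0) (a \<circ> \<delta>)" by (rule path_in_wedge_map[OF a \<delta>(1)])
  have ca\<delta>: "path_in (wedge n) (c (a 0)) (c (a 0)) (c \<circ> (a \<circ> \<delta>))" by (rule path_in_wedge_map[OF c a\<delta>])
  have cj: "?h (c \<circ> (a \<circ> \<delta>)) (conj_path \<eta> (t \<circ> \<delta>))" using conj[OF \<delta>(1)] by (simp only: \<eta>_def)
  have t\<delta>: "path_in (wedge n) 0 0 (t \<circ> \<delta>)"
    by (rule path_in_homotopic[OF homotopic_paths_sym[OF \<delta>(2)] path_in_conj[OF path_in_reversepath[OF \<nu>] \<gamma>]])
  show "\<exists>\<delta>. path_in (wedge n) 0 0 \<delta> \<and> ?h (conj_path l (c \<circ> \<delta>)) \<gamma>"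
  proof (rule exI[of _ "conj_path \<mu> (a \<circ> \<delta>)"], rule conjI)
    show "path_in (wedge n) 0 0 (conj_path \<mu> (a \<circ> \<delta>))" by (rule path_in_conj[OF \<mu> a\<delta>])
    have "?h (conj_path l (c \<circ> conj_path \<mu> (a \<circ> \<delta>))) (conj_path l (conj_path (c \<circ> \<mu>) (conj_path \<eta> (t \<circ> \<delta>))))"
      unfolding conj_path_compose
      by (rule conj_path_cong[OF conj_path_cong[OF cj c\<mu> ca\<delta>] l path_in_conj[OF c\<mu> ca\<delta>]])
    also have "?h \<dots> (conj_path l (conj_path ((c \<circ> \<mu>) +++ \<eta>) (t \<circ> \<delta>)))"
      by (rule conj_path_cong[OF conj_path_conj_path[OF c\<mu> \<eta> t\<delta>] l path_in_conj[OF c\<mu> path_in_conj[OF \<eta> t\<delta>]]])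
    also have "?h \<dots> (conj_path \<nu> (t \<circ> \<delta>))"
      unfolding \<nu>_def by (rule conj_path_conj_path[OF l path_in_join[OF c\<mu> \<eta>] t\<delta>])
    also have "?h \<dots> (conj_path \<nu> (conj_path (reversepath \<nu>) \<gamma>))"
      by (rule conj_path_cong[OF \<delta>(2) \<nu> t\<delta>])
    also have "?h \<dots> \<gamma>" by (rule conj_path_inverse[OF \<nu> \<gamma>])
    finally show "?h (conj_path l (c \<circ> conj_path \<mu> (a \<circ> \<delta>))) \<gamma>" .
  qed
qed

lemma tower_pi1_onto:
  assumes f: "\<And>i. wedge_map n (f i)" and auto: "\<And>i. pi1_automorphism n (f i)"
    and \<gamma>: "path_in (wedge n) 0 0 \<gamma>"
  shows "\<exists>\<delta>. path_in (wedge n) 0 0 \<delta> \<and> homotopic_paths (wedge n) (tower f m d \<circ> \<delta>) \<gamma>"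
  using \<gamma>
proof (induction d arbitrary: \<gamma>)
  case 0
  have "homotopic_paths (wedge n) (tower f m 0 \<circ> \<gamma>) \<gamma>" using hp_refl[OF 0] by simp
  then show ?case using 0 by blast
next
  case (Suc d)
  obtain \<delta> where \<delta>: "path_in (wedge n) 0 0 \<delta>" "homotopic_paths (wedge n) (tower f m d \<circ> \<delta>) \<gamma>"
    using Suc.IH[OF Suc.prems] by blast
  obtain \<epsilon> where \<epsilon>: "path_in (wedge n) 0 0 \<epsilon>" "homotopic_paths (wedge n) (f (m + d) \<circ> \<epsilon>) \<delta>"
    using auto[of "m + d"] \<delta>(1) unfolding pi1_automorphism_def based_loop_iff_path_in by blast
  have "homotopic_paths (wedge n) (tower f m d \<circ> (f (m + d) \<circ> \<epsilon>)) (tower f m d \<circ> \<delta>)"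
    by (rule wedge_map_homotopic[OF wedge_map_tower[of n f, OF f] \<epsilon>(2)])
  then have "homotopic_paths (wedge n) (tower f m (Suc d) \<circ> \<epsilon>) \<gamma>"
    unfolding tower.simps o_assoc[symmetric] using homotopic_paths_trans[OF _ \<delta>(2)] by blast
  then show ?case using \<epsilon>(1) by blast
qed

text \<open>With \<open>K\<close> approximated through level \<open>k\<close> and \<open>H\<close>
  at level \<open>k + d\<close>, the identity \<open>K (H x) = x\<close> read in coordinate 0 says
  that \<open>c d \<circ> a\<close> is close to the bonding map from level \<open>m\<close> to level
  0 of the first limit. Half of \<open>\<epsilon>\<close> pays for each approximation.\<close>

lemma eventually_pi1_automorphism:
  assumes f: "\<And>i. wedge_map n (f i)" "\<And>i. f i 0 = 0" and g: "\<And>i. wedge_map n (g i)" "\<And>i. g i 0 = 0"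
    and cpt: "compact (inv_limit n f)" "compact (inv_limit n g)"
    and onto: "\<And>m. (\<lambda>y. y m) ` inv_limit n f = wedge n" "\<And>m. (\<lambda>y. y m) ` inv_limit n g = wedge n"
    and H: "continuous_on (inv_limit n f) H" "\<And>x. x \<in> inv_limit n f \<Longrightarrow> H x \<in> inv_limit n g"
    and K: "continuous_on (inv_limit n g) K" "\<And>y. y \<in> inv_limit n g \<Longrightarrow> K y \<in> inv_limit n f"
    and KH: "\<And>x. x \<in> inv_limit n f \<Longrightarrow> K (H x) = x"
    and auto: "\<And>i. pi1_automorphism n (f i)"
  shows "\<exists>k. \<forall>i\<ge>k. pi1_automorphism n (g i)"
proof (cases "0 \<in> wedge n")
  case False
  \<comment> \<open>This is the degenerate case of no circles: there are no loops at 0, and both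
    conditions hold vacuously.\<close>
  then have "\<not> based_loop (wedge n) 0 \<gamma>" for \<gamma>
    using path_in_start unfolding based_loop_iff_path_in by blast
  then show ?thesis by (simp add: pi1_automorphism_def)
next
  case 0: True
  let ?h = "homotopic_paths (wedge n)"
  obtain \<epsilon> where \<epsilon>: "\<epsilon> > 0"
    "\<forall>F G. wedge_map n F \<and> wedge_map n G \<and> (\<forall>z\<in>wedge n. dist (F z) (G z) < \<epsilon>) \<longrightarrow>
      (\<exists>h. continuous_on ({0..1::real} \<times> wedge n) h \<and> h ` ({0..1} \<times> wedge n) \<subseteq> wedge n \<and>
         (\<forall>z\<in>wedge n. h (0, z) = F z \<and> h (1, z) = G z))"
    using near_maps_homotopic[of n] by (elim exE conjE)
  have coord: "continuous_on A (\<lambda>y. y m)" for A :: "(nat \<Rightarrow> complex) set" and m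
    by (rule continuous_on_subset[OF continuous_on_product_coordinates subset_UNIV])
  have cK: "continuous_on (inv_limit n g) (\<lambda>y. K y 0)"
    by (rule continuous_on_compose2[OF coord K(1) subset_UNIV])
  have imK: "(\<lambda>y. K y 0) ` inv_limit n g \<subseteq> wedge n"
    using inv_limit_in_wedge[OF K(2)] by blast
  have \<epsilon>2: "\<epsilon> / 2 > 0" using \<epsilon>(1) by simp
  obtain b k where b: "wedge_map n b" "\<forall>y\<in>inv_limit n g. dist (b (y k)) (K y 0) < \<epsilon> / 2"
    using inv_limit_approx[of n g, OF g(1) cpt(2) onto(2) cK imK \<epsilon>2] by (elim exE conjE)
  define c where "c d = b \<circ> tower g k d" for d
  have tg: "wedge_map n (tower g k d)" for d by (rule wedge_map_tower[of n g, OF g(1)])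
  have c: "wedge_map n (c d)" for d unfolding c_def by (rule wedge_map_compose[OF b(1) tg])
  have tower_0: "tower u m d 0 = 0" if "\<And>i. u i (0::complex) = 0" for u m d
    using that by (induction d) simp_all
  have c0: "c d 0 = b 0" for d by (simp add: c_def tower_0[of g, OF g(2)])
  obtain l where l: "path_in (wedge n) 0 (b 0) l"
    using wedge_path_from_0[OF wedge_mapD(2)[OF b(1) 0]] .
  have c_onto: "pi1_onto n l (c d)" for d
  proof -
    \<comment> \<open>The error in approximating \<open>H\<close> is magnified by
      \<open>c d\<close>, so the accuracy \<open>\<delta>\<close> is chosen after
      \<open>c d\<close>.\<close>
    have "uniformly_continuous_on (wedge n) (c d)"
      by (rule compact_uniformly_continuous[OF wedge_mapD(1)[OF c] compact_wedge])
    then obtain \<delta> where \<delta>: "\<delta> > 0" "\<And>z w. z \<in> wedge n \<Longrightarrow> w \<in> wedge n \<Longrightarrow> dist w z < \<delta> \<Longrightarrow> dist (c d w) (c d z) < \<epsilon> / 2"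
      using \<epsilon>2 unfolding uniformly_continuous_on_def by meson
    have cH: "continuous_on (inv_limit n f) (\<lambda>x. H x (k + d))"
      by (rule continuous_on_compose2[OF coord H(1) subset_UNIV])
    have imH: "(\<lambda>x. H x (k + d)) ` inv_limit n f \<subseteq> wedge n"
      using inv_limit_in_wedge[OF H(2)] by blast
    obtain a m where a: "wedge_map n a" "\<forall>x\<in>inv_limit n f. dist (a (x m)) (H x (k + d)) < \<delta>"
      using inv_limit_approx[of n f, OF f(1) cpt(1) onto(1) cH imH \<delta>(1)] by (elim exE conjE)
    have tf: "wedge_map n (tower f 0 m)" by (rule wedge_map_tower[of n f, OF f(1)])
    have near: "dist ((c d \<circ> a) z) (tower f 0 m z) < \<epsilon>" if z: "z \<in> wedge n" for z
    proof -
      have "z \<in> (\<lambda>x. x m) ` inv_limit n f" unfolding onto(1) by (rule z)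
      then obtain x where x: "x \<in> inv_limit n f" "z = x m" by blast
      have "tower f 0 m z = x 0" using tower_apply[OF x(1), of 0 m] x(2) by simp
      moreover have "dist (c d (a z)) (c d (H x (k + d))) < \<epsilon> / 2"
        using bspec[OF a(2) x(1)] inv_limit_in_wedge[OF H(2)[OF x(1)]] wedge_mapD(2)[OF a(1) z] x(2)
        by (intro \<delta>(2)) simp_all
      moreover have "c d (H x (k + d)) = b (H x k)"
        using tower_apply[OF H(2)[OF x(1)], of k d] by (simp add: c_def)
      moreover have "dist (b (H x k)) (x 0) < \<epsilon> / 2"
        using bspec[OF b(2) H(2)[OF x(1)]] KH[OF x(1)] by simp
      ultimately show ?thesis
        using dist_triangle[of "c d (a z)" "x 0" "b (H x k)"] by simp
    qed
    have near': "\<forall>z\<in>wedge n. dist ((c d \<circ> a) z) (tower f 0 m z) < \<epsilon>"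
      by (rule ballI) (rule near)
    have ca: "wedge_map n (c d \<circ> a)" by (rule wedge_map_compose[OF c a(1)])
    obtain h where h: "continuous_on ({0..1} \<times> wedge n) h" "h ` ({0..1::real} \<times> wedge n) \<subseteq> wedge n"
      "\<forall>z\<in>wedge n. h (0, z) = (c d \<circ> a) z \<and> h (1, z) = tower f 0 m z"
      using mp[OF spec[OF spec[OF \<epsilon>(2), of "c d \<circ> a"], of "tower f 0 m"] conjI[OF ca conjI[OF tf near']]]
      by (elim exE conjE)
    have lc: "path_in (wedge n) 0 (c d 0) l" unfolding c0 by (rule l)
    show ?thesis
      by (rule pi1_onto_of_homotopic_factor[OF c a(1) tower_0[of f, OF f(2)] h tower_pi1_onto[of n f, OF f(1) auto] lc])
  qed
  have "pi1_automorphism n (g i)" if i: "i \<ge> k" for i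
  proof -
    define d where "d = i - k"
    have cg: "c (Suc d) = c d \<circ> g i"
      using i by (simp add: c_def d_def o_assoc)
    have lc: "path_in (wedge n) 0 (c e 0) l" for e unfolding c0 by (rule l)
    \<comment> \<open>Needed at two indices: at \<open>d\<close> to cancel the outer factor for
      surjectivity of \<open>g i\<close>, and at \<open>Suc d\<close> for its injectivity.\<close>
    have inj: "?h \<gamma> \<gamma>'" if "path_in (wedge n) 0 0 \<gamma>" "path_in (wedge n) 0 0 \<gamma>'"
      "?h (conj_path l (c e \<circ> \<gamma>)) (conj_path l (c e \<circ> \<gamma>'))" for e \<gamma> \<gamma>'
      by (rule pi1_onto_imp_injective[OF c lc c_onto that])
    have g_path: "path_in (wedge n) 0 0 (g i \<circ> \<delta>)" if \<delta>: "path_in (wedge n) 0 0 \<delta>" for \<delta>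
      using path_in_wedge_map[OF g(1) \<delta>, of i] by (simp only: g(2))
    show ?thesis
      unfolding pi1_automorphism_def based_loop_iff_path_in
    proof (intro conjI allI impI)
      fix \<gamma> assume \<gamma>: "path_in (wedge n) 0 0 \<gamma>"
      have "path_in (wedge n) 0 0 (conj_path l (c d \<circ> \<gamma>))"
        using path_in_conj[OF lc path_in_wedge_map[OF c \<gamma>]] .
      then obtain \<delta> where \<delta>: "path_in (wedge n) 0 0 \<delta>" "?h (conj_path l (c (Suc d) \<circ> \<delta>)) (conj_path l (c d \<circ> \<gamma>))"
        using c_onto[of "Suc d"] unfolding pi1_onto_def by blast
      have "?h (g i \<circ> \<delta>) \<gamma>"
        using \<delta>(2) unfolding cg o_assoc[symmetric] by (rule inj[OF g_path[OF \<delta>(1)] \<gamma>])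
      then show "\<exists>\<delta>. path_in (wedge n) 0 0 \<delta> \<and> ?h (g i \<circ> \<delta>) \<gamma>" using \<delta>(1) by blast
    next
      fix \<delta> \<delta>' assume "path_in (wedge n) 0 0 \<delta> \<and> path_in (wedge n) 0 0 \<delta>' \<and> ?h (g i \<circ> \<delta>) (g i \<circ> \<delta>')"
      then have \<delta>: "path_in (wedge n) 0 0 \<delta>" "path_in (wedge n) 0 0 \<delta>'" "?h (g i \<circ> \<delta>) (g i \<circ> \<delta>')" by auto
      have pin: "path_in (wedge n) (c d 0) (c d 0) (c d \<circ> (g i \<circ> \<delta>))"
        by (rule path_in_wedge_map[OF c g_path[OF \<delta>(1)]])
      have "?h (conj_path l (c (Suc d) \<circ> \<delta>)) (conj_path l (c (Suc d) \<circ> \<delta>'))"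
        unfolding cg o_assoc[symmetric]
        by (rule conj_path_cong[OF wedge_map_homotopic[OF c \<delta>(3)] lc pin])
      then show "?h \<delta> \<delta>'" by (rule inj[OF \<delta>(1,2)])
    qed
  qed
  then show ?thesis by blast
qed

section \<open>From expansions to inverse limits\<close>

text \<open>The limit in an expansion is a subspace of an abstract product; it is identified here
  with a subset of \<open>nat \<Rightarrow> complex\<close> in its type-class topology, where
  continuity and compactness of sets are available. Compactness and surjectivity of the coordinates
  are carried over from the flow space.\<close>

lemma expansion_inv_limit:
  assumes X: "flow_space X \<phi>" and e: "expansion X \<phi> n f p x0"
  shows "wedge_map n (f i)" "f i 0 = 0"
    and "homeomorphic_map X (top_of_set (inv_limit n f)) (\<lambda>x i. p i x)"
    and "compact (inv_limit n f)" "(\<lambda>y. y m) ` inv_limit n f = wedge n"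
proof -
  show "wedge_map n (f i)" "f i 0 = 0"
    using e by (auto simp: expansion_def positive_map_def wedge_map_def)
  have "subtopology (product_topology (\<lambda>i::nat. top_of_set (wedge n)) UNIV) {y. \<forall>i. y i = f i (y (Suc i))}
      = subtopology (subtopology euclidean (PiE UNIV (\<lambda>_. wedge n))) {y. \<forall>i. y i = f i (y (Suc i))}"
    by (simp only: subtopology_product_topology[symmetric] euclidean_product_topology[symmetric])
  also have "\<dots> = top_of_set (PiE UNIV (\<lambda>_. wedge n) \<inter> {y. \<forall>i. y i = f i (y (Suc i))})"
    by (rule subtopology_subtopology)
  also have "PiE UNIV (\<lambda>_. wedge n) \<inter> {y. \<forall>i. y i = f i (y (Suc i))} = inv_limit n f"
    unfolding inv_limit_def PiE_UNIV_domain Pi_def by blast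
  finally show hom: "homeomorphic_map X (top_of_set (inv_limit n f)) (\<lambda>x i. p i x)"
    using e unfolding expansion_def by (simp only:)
  have "compact_space X" using X by (simp add: flow_space_def)
  then have "compact_space (top_of_set (inv_limit n f))"
    using homeomorphic_compact_space homeomorphic_map_imp_homeomorphic_space[OF hom] by blast
  then show "compact (inv_limit n f)"
    using compactin_subspace[of euclidean "inv_limit n f"] by (simp add: compactin_euclidean_iff)
  have "(\<lambda>x i. p i x) ` topspace X = inv_limit n f"
    using homeomorphic_imp_surjective_map[OF hom] by simp
  moreover have "(\<lambda>y. y m) ` (\<lambda>x i. p i x) ` topspace X = p m ` topspace X"
    by (simp only: image_image)
  ultimately have "(\<lambda>y. y m) ` inv_limit n f = p m ` topspace X"
    by (simp only:)
  then show "(\<lambda>y. y m) ` inv_limit n f = wedge n"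
    using e unfolding expansion_def by (simp only:)
qed

theorem theorem8p3:
  fixes X :: "'a topology" and \<phi> :: "real \<Rightarrow> 'a \<Rightarrow> 'a"
    and Y :: "'b topology" and \<psi> :: "real \<Rightarrow> 'b \<Rightarrow> 'b"
    and n :: nat
    and f g :: "nat \<Rightarrow> complex \<Rightarrow> complex"
    and p :: "nat \<Rightarrow> 'a \<Rightarrow> complex" and q :: "nat \<Rightarrow> 'b \<Rightarrow> complex"
    and x0 :: 'a and y0 :: 'b
  assumes "flow_space X \<phi>" and "minimal_flow X \<phi>" and "aperiodic_flow X \<phi>"
    and "flow_space Y \<psi>" and "minimal_flow Y \<psi>" and "aperiodic_flow Y \<psi>"
    and "expansion X \<phi> n f p x0"
    and "expansion Y \<psi> n g q y0"
    and "\<forall>i. pi1_automorphism n (f i)"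
    and "\<forall>i. \<exists>j>i. \<not> pi1_automorphism n (g j)"
  shows "\<not> flow_equivalent X \<phi> Y \<psi>"
proof
  assume "flow_equivalent X \<phi> Y \<psi>"
  then obtain e where "homeomorphic_map X Y e"
    unfolding flow_equivalent_def by blast
  then obtain e' where e: "homeomorphic_maps X Y e e'"
    by (auto simp: homeomorphic_map_maps)
  note ex = expansion_inv_limit[OF assms(1,7)] and ey = expansion_inv_limit[OF assms(4,8)]
  obtain p' where p: "homeomorphic_maps X (top_of_set (inv_limit n f)) (\<lambda>x i. p i x) p'"
    using ex(3) by (auto simp: homeomorphic_map_maps)
  obtain q' where q: "homeomorphic_maps Y (top_of_set (inv_limit n g)) (\<lambda>y i. q i y) q'"
    using ey(3) by (auto simp: homeomorphic_map_maps)
  have "homeomorphic_maps (top_of_set (inv_limit n f)) (top_of_set (inv_limit n g))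
      ((\<lambda>y i. q i y) \<circ> (e \<circ> p')) ((\<lambda>x i. p i x) \<circ> e' \<circ> q')"
    using homeomorphic_maps_compose[OF conjI[OF
        homeomorphic_maps_compose[OF conjI[OF homeomorphic_maps_sym[THEN iffD1, OF p] e]] q]] .
  then obtain H K where HK: "homeomorphic_maps (top_of_set (inv_limit n f)) (top_of_set (inv_limit n g)) H K"
    by blast
  have "\<exists>k. \<forall>i\<ge>k. pi1_automorphism n (g i)"
  proof (rule eventually_pi1_automorphism[of n f g H K])
    show "continuous_on (inv_limit n f) H" "continuous_on (inv_limit n g) K"
      using HK by (simp_all add: homeomorphic_maps_def)
    show "H x \<in> inv_limit n g" "K (H x) = x" if "x \<in> inv_limit n f" for x
      using HK that by (auto simp: homeomorphic_maps_def continuous_map_def)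
    show "K y \<in> inv_limit n f" if "y \<in> inv_limit n g" for y
      using HK that by (auto simp: homeomorphic_maps_def continuous_map_def)
    show "pi1_automorphism n (f i)" for i
      using assms(9) by blast
  qed (rule ex ey)+
  then show False
    using assms(10) by (meson less_imp_le order_trans nat_le_linear)
qed

end
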